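(* Let $\mathcal{A}$ be a Dedekind complete unital $f$-algebra with the countable sup property, such that its identity element $e$ is also a strong order unit of $\mathcal{A}$, and such that it is complete in the submultiplicative order unit norm $\|\cdot\|_e$ on $\mathcal{A}$. Suppose that $\mathcal{A}$ admits a (necessarily unique) Hausdorff uo-Lebesgue topology $\widehat\tau_{\mathcal{A}}$. Let $\mathcal{B}$ be an associative subalgebra of $\mathcal{A}$ such that $\overline{\mathcal{B}}^{\|\cdot\|_e}$ contains a strong order unit of $\mathcal{A}$. Then the following ten subsets of $\mathcal{A}$ are all equal: $$\overline{\mathcal{B}}^{\widehat\tau_{\mathcal{A}}}=a_{\sigma\mathrm{o}}(\mathcal{B})=a_{\mathrm{o}}(\mathcal{B})=a_{\sigma\mathrm{uo}}(\mathcal{B})=a_{\mathrm{uo}}(\mathcal{B})=$$ $$\overline{\overline{\mathcal{B}}^{\|\cdot\|_e}}^{\widehat\tau_{\mathcal{A}}}=a_{\sigma\mathrm{o}}\bigl(\overline{\mathcal{B}}^{\|\cdot\|_e}\bigr)=a_{\mathrm{o}}\bigl(\overline{\mathcal{B}}^{\|\cdot\|_e}\bigr)=a_{\sigma\mathrm{uo}}\bigl(\overline{\mathcal{B}}^{\|\cdot\|_e}\bigr)=a_{\mathrm{uo}}\bigl(\overline{\mathcal{B}}^{\|\cdot\|_e}\bigr),$$ where all closures and adherences are taken in $\mathcal{A}$.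
   Context: All vector lattices (in particular those underlying $f$-algebras) are real and Archimedean. An $f$-algebra is an associative algebra that is a vector lattice in which products of positive elements are positive and in which $x\wedge y=0$ and $z\ge 0$ imply $(xz)\wedge y=(zx)\wedge y=0$. A strong order unit of $\mathcal{A}$ is an element $u$ such that for every $x\in\mathcal{A}$ there is $\lambda\ge0$ with $|x|\le\lambda|u|$; $\|x\|_e=\inf\{\lambda\ge0:|x|\le\lambda e\}$. $\mathcal{A}$ has the countable sup property if every non-empty subset that has a supremum contains an at most countable subset with the same supremum. Subalgebras are not assumed to be unital. In a vector lattice $G$, a net $(x_\alpha)_{\alpha\in A}$ is order convergent to $x$ ($x_\alpha\xrightarrow{\mathrm{o}}x$) if there is a net $(y_\beta)_{\beta\in B}$ in $G$ with $y_\beta\downarrow 0$ such that for every $\beta_0\in B$ there is $\alpha_0\in A$ with $|x-x_\alpha|\le y_{\beta_0}$ for all $\alpha\ge\alpha_0$; it is unbounded order convergent to $x$ ($x_\alpha\xrightarrow{\mathrm{uo}}x$) if $|x_\alpha-x|\wedge y\xrightarrow{\mathrm{o}}0$ in $G$ for all $y\in G^+$. A uo-Lebesgue topology on $G$ is a locally solid linear topology $\tau$ on $G$ such that $x_\alpha\xrightarrow{\mathrm{uo}}0$ implies $x_\alpha\xrightarrow{\tau}0$ for every net; $G$ admits at most one Hausdorff one, denoted $\widehat\tau_G$. For $S\subseteq G$, $a_{\mathrm{o}}(S)$ (resp. $a_{\sigma\mathrm{o}}(S)$) is the set of all $x\in G$ for which there is a net (resp. a sequence) in $S$ that is order convergent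 to $x$ in $G$; $a_{\mathrm{uo}}(S)$ and $a_{\sigma\mathrm{uo}}(S)$ are defined likewise with unbounded order convergence. $\overline{S}^{\tau}$ is the closure of $S$ in the topology (or norm) $\tau$. *)

theory Defs
  imports "HOL-Analysis.Analysis" "HOL-Library.Lattice_Algebras" "HOL-Library.Lub_Glb"
begin

section \<open>Vector lattices and \<open>f\<close>-algebras\<close>

class archimedean_vector_lattice = ordered_real_vector + lattice_ab_group_add_abs +
  assumes archimedean:
    "0 \<le> x \<Longrightarrow> (\<And>n. y \<le> inverse (real (Suc n)) *\<^sub>R x) \<Longrightarrow> y \<le> 0"

text \<open>No unit is built into the class: \<^class>\<open>real_algebra_1\<close> would
  exclude the zero algebra.\<close>

class f_algebra = archimedean_vector_lattice + real_algebra +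
  assumes times_nonneg: "0 \<le> x \<Longrightarrow> 0 \<le> y \<Longrightarrow> 0 \<le> x * y"
    and f_right: "inf x y = 0 \<Longrightarrow> 0 \<le> z \<Longrightarrow> inf (x * z) y = 0"
    and f_left: "inf x y = 0 \<Longrightarrow> 0 \<le> z \<Longrightarrow> inf (z * x) y = 0"

instance f_algebra \<subseteq> lattice_ring
proof
  fix a b c :: 'a
  assume "a \<le> b" "0 \<le> c"
  then have "0 \<le> c * (b - a)" "0 \<le> (b - a) * c"
    by (auto intro: times_nonneg)
  then show "c * a \<le> c * b" "a * c \<le> b * c"
    by (auto simp: algebra_simps)
qed

instance real :: archimedean_vector_lattice
proof
  fix x y :: real
  assume x: "0 \<le> x" and *: "\<And>n. y \<le> inverse (real (Suc n)) *\<^sub>R x"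
  have "(\<lambda>n. inverse (real (Suc n)) *\<^sub>R x) \<longlonglongrightarrow> 0 *\<^sub>R x"
    by (intro tendsto_scaleR LIMSEQ_inverse_real_of_nat tendsto_const)
  then show "y \<le> 0"
    using * by (intro LIMSEQ_le_const[of _ 0 y]) auto
qed

instance real :: f_algebra
proof
  fix x y z :: real
  assume xy: "inf x y = 0" and z: "0 \<le> z"
  have "0 \<le> x" "0 \<le> y" using xy by (metis inf.cobounded1) (metis xy inf.cobounded2)
  moreover have "x = 0 \<or> y = 0" using xy by (simp add: inf_real_def min_def split: if_splits)
  ultimately show "inf (x * z) y = 0" "inf (z * x) y = 0"
    using z by (auto simp: inf_real_def)
qed simp

definition strong_order_unit :: "'a::archimedean_vector_lattice \<Rightarrow> bool" where
  "strong_order_unit u \<longleftrightarrow> (\<forall>x. \<exists>c::real. 0 \<le> c \<and> \<bar>x\<bar> \<le> c *\<^sub>R \<bar>u\<bar>)"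

definition order_unit_norm :: "'a::archimedean_vector_lattice \<Rightarrow> 'a \<Rightarrow> real" where
  "order_unit_norm e x = Inf {c. 0 \<le> c \<and> \<bar>x\<bar> \<le> c *\<^sub>R e}"

definition order_unit_dist :: "'a::archimedean_vector_lattice \<Rightarrow> 'a \<Rightarrow> 'a \<Rightarrow> real" where
  "order_unit_dist e x y = order_unit_norm e (x - y)"

definition order_unit_topology :: "'a::archimedean_vector_lattice \<Rightarrow> 'a topology" where
  "order_unit_topology e = Metric_space.mtopology UNIV (order_unit_dist e)"

definition order_unit_complete :: "'a::archimedean_vector_lattice \<Rightarrow> bool" where
  "order_unit_complete e \<longleftrightarrow> Metric_space.mcomplete UNIV (order_unit_dist e)"

definition countable_sup_property :: "'a::archimedean_vector_lattice itself \<Rightarrow> bool" where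
  "countable_sup_property _ \<longleftrightarrow>
    (\<forall>(S::'a set) s. S \<noteq> {} \<and> isLub UNIV S s \<longrightarrow>
      (\<exists>C\<subseteq>S. countable C \<and> isLub UNIV C s))"

definition subalgebra :: "'a::real_algebra set \<Rightarrow> bool" where
  "subalgebra B \<longleftrightarrow> subspace B \<and> (\<forall>x\<in>B. \<forall>y\<in>B. x * y \<in> B)"


section \<open>Nets\<close>

text \<open>A net is a function \<open>f\<close> on a non-empty set \<open>A\<close> that is directed by a
  preorder \<open>r\<close>, where \<open>r a b\<close> means that \<open>b\<close> is later than \<open>a\<close>.\<close>

definition directed :: "'i set \<Rightarrow> ('i \<Rightarrow> 'i \<Rightarrow> bool) \<Rightarrow> bool" where
  "directed A r \<longleftrightarrow> A \<noteq> {} \<and> reflp_on A r \<and> transp_on A r \<and>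
    (\<forall>a\<in>A. \<forall>b\<in>A. \<exists>c\<in>A. r a c \<and> r b c)"

definition eventually_net :: "'i set \<Rightarrow> ('i \<Rightarrow> 'i \<Rightarrow> bool) \<Rightarrow> ('i \<Rightarrow> bool) \<Rightarrow> bool" where
  "eventually_net A r P \<longleftrightarrow> (\<exists>a\<^sub>0\<in>A. \<forall>a\<in>A. r a\<^sub>0 a \<longrightarrow> P a)"

definition decreases_to_0 ::
  "'i set \<Rightarrow> ('i \<Rightarrow> 'i \<Rightarrow> bool) \<Rightarrow> ('i \<Rightarrow> 'a::archimedean_vector_lattice) \<Rightarrow> bool" where
  "decreases_to_0 B s y \<longleftrightarrow> directed B s \<and>
    (\<forall>a\<in>B. \<forall>b\<in>B. s a b \<longrightarrow> y b \<le> y a) \<and> isGlb UNIV (y ` B) 0"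

text \<open>HOL cannot quantify over the type of an index set inside a definition. The dominating
  net below is therefore indexed by a subset of \<^typ>\<open>'a\<close>, and nets in a subset of
  \<^typ>\<open>'a\<close> (or all nets in \<^typ>\<open>'a\<close>) are indexed by subsets of
  \<^typ>\<open>'a set \<times> 'a\<close>. The lemmas \<open>order_convI\<close>, \<open>o_adherenceI\<close>, \<open>uo_adherenceI\<close> and
  \<open>uo_LebesgueD\<close> show that nothing is lost: index sets in arbitrary types give the
  same notions.\<close>

definition order_conv ::
  "'i set \<Rightarrow> ('i \<Rightarrow> 'i \<Rightarrow> bool) \<Rightarrow> ('i \<Rightarrow> 'a::archimedean_vector_lattice) \<Rightarrow> 'a \<Rightarrow> bool" where
  "order_conv A r f x \<longleftrightarrow>
    (\<exists>(B::'a set) s y. decreases_to_0 B s y \<and>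
      (\<forall>b\<in>B. eventually_net A r (\<lambda>a. \<bar>x - f a\<bar> \<le> y b)))"

definition uo_conv ::
  "'i set \<Rightarrow> ('i \<Rightarrow> 'i \<Rightarrow> bool) \<Rightarrow> ('i \<Rightarrow> 'a::archimedean_vector_lattice) \<Rightarrow> 'a \<Rightarrow> bool" where
  "uo_conv A r f x \<longleftrightarrow> (\<forall>y\<ge>0. order_conv A r (\<lambda>a. inf \<bar>f a - x\<bar> y) 0)"

definition topology_conv ::
  "'a topology \<Rightarrow> 'i set \<Rightarrow> ('i \<Rightarrow> 'i \<Rightarrow> bool) \<Rightarrow> ('i \<Rightarrow> 'a) \<Rightarrow> 'a \<Rightarrow> bool" where
  "topology_conv T A r f x \<longleftrightarrow>
    x \<in> topspace T \<and> (\<forall>U. openin T U \<and> x \<in> U \<longrightarrow> eventually_net A r (\<lambda>a. f a \<in> U))"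

definition o_adherence :: "'a::archimedean_vector_lattice set \<Rightarrow> 'a set" where
  "o_adherence S = {x. \<exists>(A::('a set \<times> 'a) set) r f.
    directed A r \<and> f ` A \<subseteq> S \<and> order_conv A r f x}"

definition uo_adherence :: "'a::archimedean_vector_lattice set \<Rightarrow> 'a set" where
  "uo_adherence S = {x. \<exists>(A::('a set \<times> 'a) set) r f.
    directed A r \<and> f ` A \<subseteq> S \<and> uo_conv A r f x}"

definition sigma_o_adherence :: "'a::archimedean_vector_lattice set \<Rightarrow> 'a set" where
  "sigma_o_adherence S = {x. \<exists>f::nat \<Rightarrow> 'a. range f \<subseteq> S \<and> order_conv UNIV (\<le>) f x}"

definition sigma_uo_adherence :: "'a::archimedean_vector_lattice set \<Rightarrow> 'a set" where
  "sigma_uo_adherence S = {x. \<exists>f::nat \<Rightarrow> 'a. range f \<subseteq> S \<and> uo_conv UNIV (\<le>) f x}"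


section \<open>uo-Lebesgue topologies\<close>

definition linear_topology :: "'a::real_vector topology \<Rightarrow> bool" where
  "linear_topology T \<longleftrightarrow> topspace T = UNIV \<and>
    continuous_map (prod_topology T T) T (\<lambda>(x, y). x + y) \<and>
    continuous_map (prod_topology euclideanreal T) T (\<lambda>(c, x). c *\<^sub>R x)"

definition solid :: "'a::archimedean_vector_lattice set \<Rightarrow> bool" where
  "solid S \<longleftrightarrow> (\<forall>x y. y \<in> S \<and> \<bar>x\<bar> \<le> \<bar>y\<bar> \<longrightarrow> x \<in> S)"

definition locally_solid :: "'a::archimedean_vector_lattice topology \<Rightarrow> bool" where
  "locally_solid T \<longleftrightarrow>
    (\<forall>U. openin T U \<and> 0 \<in> U \<longrightarrow> (\<exists>V S. openin T V \<and> 0 \<in> V \<and> V \<subseteq> S \<and> S \<subseteq> U \<and> solid S))"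

definition uo_Lebesgue :: "'a::archimedean_vector_lattice topology \<Rightarrow> bool" where
  "uo_Lebesgue T \<longleftrightarrow> linear_topology T \<and> locally_solid T \<and>
    (\<forall>(A::('a set \<times> 'a) set) r f.
      directed A r \<and> uo_conv A r f 0 \<longrightarrow> topology_conv T A r f 0)"


section \<open>Independence of the choice of index types\<close>

lemma order_convI:
  fixes y :: "'b \<Rightarrow> 'a::archimedean_vector_lattice"
  assumes "decreases_to_0 B s y"
    and "\<And>b. b \<in> B \<Longrightarrow> eventually_net A r (\<lambda>a. \<bar>x - f a\<bar> \<le> y b)"
  shows "order_conv A r f x"
proof -
  have "directed (y ` B) (\<ge>)"
    unfolding directed_def
  proof (intro conjI ballI)
    show "y ` B \<noteq> {}"
      using assms(1) by (simp add: decreases_to_0_def directed_def)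
    show "reflp_on (y ` B) (\<ge>)" "transp_on (y ` B) (\<ge>)"
      by (auto simp: reflp_on_def transp_on_def)
    fix u v assume "u \<in> y ` B" "v \<in> y ` B"
    then obtain a b where ab: "a \<in> B" "b \<in> B" "u = y a" "v = y b" by blast
    then obtain c where "c \<in> B" "s a c" "s b c"
      using assms(1) unfolding decreases_to_0_def directed_def by blast
    then have "y c \<le> u" "y c \<le> v" "y c \<in> y ` B"
      using assms(1) ab by (simp_all add: decreases_to_0_def)
    then show "\<exists>w\<in>y ` B. w \<le> u \<and> w \<le> v" by blast
  qed
  then have "decreases_to_0 (y ` B) (\<ge>) (\<lambda>z. z)"
    using assms(1) by (auto simp: decreases_to_0_def)
  then show ?thesis
    unfolding order_conv_def using assms(2)
    by (intro exI[of _ "y ` B"] exI[of _ "(\<ge>)"] exI[of _ "\<lambda>z. z"]) auto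
qed

text \<open>Every net in \<^typ>\<open>'a\<close> has the same eventual behaviour as a net
  indexed by its tails with a marked point.\<close>

lemma net_reindex:
  fixes f :: "'i \<Rightarrow> 'a"
  assumes "directed A r"
  obtains A' :: "('a set \<times> 'a) set" and r' f' where
    "directed A' r'" "f' ` A' \<subseteq> f ` A"
    "\<And>P. eventually_net A' r' (\<lambda>a. P (f' a)) \<longleftrightarrow> eventually_net A r (\<lambda>a. P (f a))"
proof -
  define tl where "tl a = f ` {b\<in>A. r a b}" for a
  define A' where "A' = {(tl a, f b) |a b. a \<in> A \<and> b \<in> A \<and> r a b}"
  define r' :: "'a set \<times> 'a \<Rightarrow> 'a set \<times> 'a \<Rightarrow> bool"
    where "r' p q \<longleftrightarrow> fst q \<subseteq> fst p" for p q
  have refl: "r a a" if "a \<in> A" for a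
    using assms that by (auto simp: directed_def reflp_on_def)
  have trans: "r a c" if "a \<in> A" "b \<in> A" "c \<in> A" "r a b" "r b c" for a b c
    using assms that unfolding directed_def transp_on_def by blast
  have mono: "tl b \<subseteq> tl a" if "a \<in> A" "b \<in> A" "r a b" for a b
    using that trans unfolding tl_def by blast
  have "directed A' r'"
    unfolding directed_def
  proof (intro conjI ballI)
    show "A' \<noteq> {}"
      using assms refl by (auto simp: A'_def directed_def)
    show "reflp_on A' r'" "transp_on A' r'"
      by (auto simp: r'_def reflp_on_def transp_on_def)
    fix p q assume "p \<in> A'" "q \<in> A'"
    then obtain a b where ab: "a \<in> A" "b \<in> A" "fst p = tl a" "fst q = tl b"
      by (auto simp: A'_def)
    then obtain c where c: "c \<in> A" "r a c" "r b c"
      using assms unfolding directed_def by meson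
    then have "(tl c, f c) \<in> A'"
      using refl by (auto simp: A'_def)
    then show "\<exists>c\<in>A'. r' p c \<and> r' q c"
      using ab c mono by (intro bexI[of _ "(tl c, f c)"]) (auto simp: r'_def)
  qed
  moreover have "snd ` A' \<subseteq> f ` A"
    by (auto simp: A'_def)
  moreover have "eventually_net A' r' (\<lambda>a. P (snd a)) \<longleftrightarrow> eventually_net A r (\<lambda>a. P (f a))" for P
  proof
    assume "eventually_net A' r' (\<lambda>a. P (snd a))"
    then obtain p where p: "p \<in> A'" "\<And>q. q \<in> A' \<Longrightarrow> r' p q \<Longrightarrow> P (snd q)"
      by (auto simp: eventually_net_def)
    then obtain a where a: "a \<in> A" "fst p = tl a"
      by (auto simp: A'_def)
    have "P (f b)" if "b \<in> A" "r a b" for b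
    proof -
      have "(tl a, f b) \<in> A'" using a that by (auto simp: A'_def)
      moreover have "r' p (tl a, f b)" using a by (simp add: r'_def)
      ultimately show ?thesis using p(2) by fastforce
    qed
    then show "eventually_net A r (\<lambda>a. P (f a))"
      using a by (auto simp: eventually_net_def)
  next
    assume "eventually_net A r (\<lambda>a. P (f a))"
    then obtain a where a: "a \<in> A" "\<And>b. b \<in> A \<Longrightarrow> r a b \<Longrightarrow> P (f b)"
      by (auto simp: eventually_net_def)
    have "P (snd q)" if q: "q \<in> A'" "r' (tl a, f a) q" for q
    proof -
      have "snd q \<in> fst q" using q(1) by (auto simp: A'_def tl_def)
      then have "snd q \<in> tl a" using q(2) by (auto simp: r'_def)
      then show ?thesis using a(2) by (auto simp: tl_def)
    qed
    moreover have "(tl a, f a) \<in> A'" using a refl by (auto simp: A'_def)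
    ultimately show "eventually_net A' r' (\<lambda>a. P (snd a))"
      unfolding eventually_net_def by blast
  qed
  ultimately show thesis by (rule that)
qed

lemma conv_reindex:
  fixes f :: "'i \<Rightarrow> 'a::archimedean_vector_lattice"
  assumes "\<And>P. eventually_net A' r' (\<lambda>a. P (f' a)) \<longleftrightarrow> eventually_net A r (\<lambda>a. P (f a))"
  shows "order_conv A' r' f' x \<longleftrightarrow> order_conv A r f x"
    and "uo_conv A' r' f' x \<longleftrightarrow> uo_conv A r f x"
    and "topology_conv T A' r' f' x \<longleftrightarrow> topology_conv T A r f x"
proof -
  have *: "order_conv A' r' (\<lambda>a. g (f' a)) w \<longleftrightarrow> order_conv A r (\<lambda>a. g (f a)) w"
    for g :: "'a \<Rightarrow> 'a" and w
  proof -
    have "eventually_net A' r' (\<lambda>a. \<bar>w - g (f' a)\<bar> \<le> v) \<longleftrightarrow>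
        eventually_net A r (\<lambda>a. \<bar>w - g (f a)\<bar> \<le> v)" for v
      by (rule assms)
    then show ?thesis by (simp add: order_conv_def)
  qed
  show "order_conv A' r' f' x \<longleftrightarrow> order_conv A r f x"
    using *[of "\<lambda>z. z"] by simp
  have "order_conv A' r' (\<lambda>a. inf \<bar>f' a - x\<bar> u) 0 \<longleftrightarrow>
      order_conv A r (\<lambda>a. inf \<bar>f a - x\<bar> u) 0" for u
    by (rule *)
  then show "uo_conv A' r' f' x \<longleftrightarrow> uo_conv A r f x"
    by (simp add: uo_conv_def)
  have "eventually_net A' r' (\<lambda>a. f' a \<in> U) \<longleftrightarrow> eventually_net A r (\<lambda>a. f a \<in> U)" for U
    by (rule assms)
  then show "topology_conv T A' r' f' x \<longleftrightarrow> topology_conv T A r f x"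
    by (simp add: topology_conv_def)
qed

lemma o_adherenceI:
  fixes f :: "'i \<Rightarrow> 'a::archimedean_vector_lattice"
  assumes "directed A r" "f ` A \<subseteq> S" "order_conv A r f x"
  shows "x \<in> o_adherence S"
proof -
  obtain A' :: "('a set \<times> 'a) set" and r' f' where
    *: "directed A' r'" "f' ` A' \<subseteq> f ` A"
    "\<And>P. eventually_net A' r' (\<lambda>a. P (f' a)) \<longleftrightarrow> eventually_net A r (\<lambda>a. P (f a))"
    using net_reindex[OF assms(1), of f] by metis
  have "order_conv A' r' f' x" using conv_reindex(1)[of A' r' f' A r f, OF *(3)] assms(3) by simp
  then show ?thesis using * assms(2) unfolding o_adherence_def by blast
qed

lemma uo_adherenceI:
  fixes f :: "'i \<Rightarrow> 'a::archimedean_vector_lattice"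
  assumes "directed A r" "f ` A \<subseteq> S" "uo_conv A r f x"
  shows "x \<in> uo_adherence S"
proof -
  obtain A' :: "('a set \<times> 'a) set" and r' f' where
    *: "directed A' r'" "f' ` A' \<subseteq> f ` A"
    "\<And>P. eventually_net A' r' (\<lambda>a. P (f' a)) \<longleftrightarrow> eventually_net A r (\<lambda>a. P (f a))"
    using net_reindex[OF assms(1), of f] by metis
  have "uo_conv A' r' f' x" using conv_reindex(2)[of A' r' f' A r f, OF *(3)] assms(3) by simp
  then show ?thesis using * assms(2) unfolding uo_adherence_def by blast
qed

lemma uo_LebesgueD:
  fixes f :: "'i \<Rightarrow> 'a::archimedean_vector_lattice"
  assumes "uo_Lebesgue T" "directed A r" "uo_conv A r f 0"
  shows "topology_conv T A r f 0"
proof -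
  obtain A' :: "('a set \<times> 'a) set" and r' f' where
    *: "directed A' r'"
    "\<And>P. eventually_net A' r' (\<lambda>a. P (f' a)) \<longleftrightarrow> eventually_net A r (\<lambda>a. P (f a))"
    using net_reindex[OF assms(2), of f] by metis
  have "uo_conv A' r' f' 0" using conv_reindex(2)[of A' r' f' A r f, OF *(2)] assms(3) by simp
  then have "topology_conv T A' r' f' 0" using assms(1) * unfolding uo_Lebesgue_def by blast
  then show ?thesis using conv_reindex(3)[where A' = A' and r' = r' and f' = f' and A = A and r = r and f = f, OF *(2)] by simp
qed


section \<open>The order unit metric\<close>

text \<open>The constants of \<^locale>\<open>Metric_space\<close> used above are meaningful, since
  the identity of a unital \<open>f\<close>-algebra is positive.\<close>

lemma unit_nonneg:
  fixes e :: "'a::f_algebra"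
  assumes "\<And>x. e * x = x" "\<And>x. x * e = x"
  shows "0 \<le> e"
proof -
  define p where "p = sup e 0"
  define q where "q = sup (- e) 0"
  have q: "q = p - e"
    using add_sup_distrib_right[of e 0 "- e"] by (simp add: p_def q_def sup_commute)
  have pos: "0 \<le> p" "0 \<le> q" by (simp_all add: p_def q_def)
  have p_eq: "p = e + q" using q by simp
  have q_eq: "q = - inf e 0" by (simp add: q_def neg_inf_eq_sup)
  have "inf p q = inf e 0 + q"
    by (simp only: add_inf_distrib_right p_eq add_0_left)
  also have "\<dots> = 0" by (simp only: q_eq add.right_inverse)
  finally have pq: "inf p q = 0" .
  have "inf (p * q) q = 0" using f_right[OF pq pos(2)] .
  then have "inf q (p * q) = 0" by (simp add: inf_commute)
  then have "inf (p * q) (p * q) = 0" by (rule f_left[OF _ pos(1)])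
  then have 1: "p * q = 0" by simp
  have "inf q p = 0" using pq by (simp add: inf_commute)
  then have "inf (q * p) p = 0" using f_right pos by blast
  then have "inf p (q * p) = 0" by (simp add: inf_commute)
  then have "inf (q * p) (q * p) = 0" by (rule f_left[OF _ pos(2)])
  then have 2: "q * p = 0" by simp
  have "e = e * e" using assms by simp
  also have "\<dots> = (p - q) * (p - q)" using q by simp
  also have "\<dots> = p * p + q * q" using 1 2 by (simp add: algebra_simps)
  also have "\<dots> \<ge> 0" using pos by (intro add_nonneg_nonneg times_nonneg)
  finally show ?thesis .
qed

lemma
  fixes e :: "'a::archimedean_vector_lattice"
  assumes "strong_order_unit e" "0 \<le> e"
  shows order_unit_norm_nonneg: "0 \<le> order_unit_norm e x"
    and order_unit_norm_bound: "\<bar>x\<bar> \<le> order_unit_norm e x *\<^sub>R e"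
    and order_unit_norm_le: "0 \<le> c \<Longrightarrow> \<bar>x\<bar> \<le> c *\<^sub>R e \<Longrightarrow> order_unit_norm e x \<le> c"
proof -
  let ?S = "{c. 0 \<le> c \<and> \<bar>x\<bar> \<le> c *\<^sub>R e}"
  have ne: "?S \<noteq> {}"
    using assms by (auto simp: strong_order_unit_def)
  have bdd: "bdd_below ?S" by (auto intro: bdd_belowI[of _ 0])
  show "0 \<le> order_unit_norm e x"
    unfolding order_unit_norm_def using ne by (auto intro: cInf_greatest)
  show "order_unit_norm e x \<le> c" if "0 \<le> c" "\<bar>x\<bar> \<le> c *\<^sub>R e"
    unfolding order_unit_norm_def using bdd that by (auto intro: cInf_lower)
  have "\<bar>x\<bar> - order_unit_norm e x *\<^sub>R e \<le> 0"
  proof (rule archimedean[OF assms(2)])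
    fix n
    have "Inf ?S < Inf ?S + inverse (real (Suc n))" by simp
    then obtain c where "c \<in> ?S" "c < Inf ?S + inverse (real (Suc n))"
      using cInf_lessD[OF ne] by blast
    then have "\<bar>x\<bar> \<le> c *\<^sub>R e" "c *\<^sub>R e \<le> (Inf ?S + inverse (real (Suc n))) *\<^sub>R e"
      using assms(2) by (auto intro: scaleR_right_mono)
    then have "\<bar>x\<bar> \<le> (order_unit_norm e x + inverse (real (Suc n))) *\<^sub>R e"
      unfolding order_unit_norm_def by (rule order_trans)
    then show "\<bar>x\<bar> - order_unit_norm e x *\<^sub>R e \<le> inverse (real (Suc n)) *\<^sub>R e"
      by (simp add: scaleR_left_distrib algebra_simps)
  qed
  then show "\<bar>x\<bar> \<le> order_unit_norm e x *\<^sub>R e" by simp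
qed

lemma Metric_space_order_unit_dist:
  fixes e :: "'a::archimedean_vector_lattice"
  assumes "strong_order_unit e" "0 \<le> e"
  shows "Metric_space UNIV (order_unit_dist e)"
proof
  note nn = order_unit_norm_nonneg[OF assms] and bd = order_unit_norm_bound[OF assms]
    and le = order_unit_norm_le[OF assms]
  fix x y z :: 'a
  show "0 \<le> order_unit_dist e x y" by (simp add: order_unit_dist_def nn)
  show "order_unit_dist e x y = order_unit_dist e y x"
    by (simp add: order_unit_dist_def order_unit_norm_def abs_minus_commute)
  show "order_unit_dist e x y = 0 \<longleftrightarrow> x = y"
  proof
    assume "order_unit_dist e x y = 0"
    then have "\<bar>x - y\<bar> \<le> 0" using bd[of "x - y"] by (simp add: order_unit_dist_def)
    then show "x = y" by simp
  next
    assume "x = y"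
    then have "order_unit_dist e x y \<le> 0" by (simp add: order_unit_dist_def le)
    then show "order_unit_dist e x y = 0"
      using nn[of "x - y"] by (simp add: order_unit_dist_def)
  qed
  have "\<bar>x - z\<bar> \<le> \<bar>x - y\<bar> + \<bar>y - z\<bar>"
    using abs_triangle_ineq[of "x - y" "y - z"] by simp
  also have "\<dots> \<le> (order_unit_norm e (x - y) + order_unit_norm e (y - z)) *\<^sub>R e"
    using add_mono[OF bd[of "x - y"] bd[of "y - z"]] by (simp add: scaleR_left_distrib)
  finally show "order_unit_dist e x z \<le> order_unit_dist e x y + order_unit_dist e y z"
    unfolding order_unit_dist_def using nn by (intro le add_nonneg_nonneg) auto
qed

end

theory Submission
  imports Defs
begin

text \<open>
  Let \<open>C\<close> be the closure of \<open>B\<close> in the order unit norm. The inclusions between the four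
  adherences are formal, and a uo-Lebesgue topology makes \<open>T closure_of S\<close> an upper bound of
  all adherences of \<open>S\<close>. So every one of the ten sets lies between \<open>sigma_o_adherence B\<close> and
  \<open>T closure_of C\<close>, and it suffices to show that each \<open>x\<close> in \<open>T closure_of C\<close> is the order
  limit of a sequence in \<open>B\<close> (\<open>closure_subset_sigma_o_adherence\<close>). Two ideas carry this.

  The algebra \<open>C\<close> is a vector sublattice that contains \<open>e\<close>. This is the Stone-Weierstrass
  argument, done inside the \<open>f\<close>-algebra with explicit polynomials without constant term, since
  \<open>B\<close> need not contain \<open>e\<close>: iterates for the square root of \<open>x * x\<close> give \<open>\<bar>x\<bar>\<close> (\<open>abs_mem\<close>), and
  \<open>e - (e - v) ^ n\<close> gives \<open>e\<close> from a \<open>v\<close> that is bounded away from zero (\<open>unit_mem\<close>).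
  Consequently an element of \<open>C\<close> that is \<open>T\<close>-close to \<open>x\<close> can be clipped to an interval
  \<open>[- m e, m e]\<close> that contains \<open>x\<close>, which does not increase its distance to \<open>x\<close>; then it can be
  replaced by a nearby element of \<open>B\<close>. All approximations stay order bounded.

  On order bounded sets, suitable countably many neighbourhoods of zero control order
  convergence. Take solid neighbourhoods with \<open>V (n+1) + V (n+1) \<subseteq> V n\<close>. If \<open>f n - x \<in> V n\<close> and
  the \<open>f n\<close> are order bounded, the limit superior of \<open>\<bar>f n - x\<bar>\<close> belongs to every \<open>V n\<close>: finite
  suprema are dominated by sums, and passing from finite to countable suprema costs one
  index because monotone order limits are \<open>T\<close>-limits. So \<open>f\<close> is order convergent to \<open>x\<close> as soon as
  \<open>0\<close> is the only element of \<open>\<Inter>n. V n\<close> between \<open>0\<close> and the bound (\<open>order_conv_of_nbhd_chain\<close>). A chain with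
  this property exists (\<open>exists_separating_chain\<close>): each chain has a largest element \<open>p\<close> of its
  intersection below the bound; the infimum of these \<open>p\<close> over all chains is \<open>0\<close> because \<open>T\<close> is
  Hausdorff; by the countable sup property, countably many chains suffice, and these can be
  merged into one.
\<close>

section \<open>Closed subalgebras for the order unit norm\<close>

lemma mult_eq_0_of_disjoint:
  fixes p q :: "'a::f_algebra"
  assumes "inf p q = 0"
  shows "p * q = 0"
proof -
  have "0 \<le> p" "0 \<le> q"
    using assms by (metis inf.cobounded1) (metis assms inf.cobounded2)
  then have "inf (p * q) q = 0" using f_right assms by blast
  then have "inf q (p * q) = 0" by (simp add: inf_commute)
  then have "inf (p * q) (p * q) = 0" using f_left \<open>0 \<le> p\<close> by blast
  then show ?thesis by simp
qed

lemma inf_pprt_uminus_nprt: "inf (pprt x) (- nprt x) = (0::'a::lattice_ab_group_add)"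
proof -
  have "inf (pprt x) (- nprt x) = inf (x + (- nprt x)) (0 + (- nprt x))"
    using prts[of x] by (metis add.left_neutral add_diff_cancel_right' diff_conv_add_uminus)
  also have "\<dots> = inf x 0 + (- nprt x)"
    by (simp only: add_inf_distrib_right)
  also have "\<dots> = 0" by (simp only: nprt_def add.right_inverse)
  finally show ?thesis .
qed

text \<open>The positive and the negative part are disjoint, so their products vanish and the mixed
  terms in both squares disappear.\<close>

lemma abs_mult_abs_self:
  fixes x :: "'a::f_algebra"
  shows "\<bar>x\<bar> * \<bar>x\<bar> = x * x"
proof -
  have 1: "pprt x * nprt x = 0"
    using mult_eq_0_of_disjoint[OF inf_pprt_uminus_nprt[of x]] by simp
  have "inf (- nprt x) (pprt x) = 0"
    using inf_pprt_uminus_nprt[of x] by (simp add: inf_commute)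
  from mult_eq_0_of_disjoint[OF this] have 2: "nprt x * pprt x = 0" by simp
  have "\<bar>x\<bar> * \<bar>x\<bar> = (pprt x - nprt x) * (pprt x - nprt x)" by (simp only: abs_prts)
  also have "\<dots> = (pprt x + nprt x) * (pprt x + nprt x)"
    using 1 2 by (simp add: algebra_simps)
  also have "\<dots> = x * x" by (simp only: prts[symmetric])
  finally show ?thesis .
qed

text \<open>The classical iteration for the square root of \<open>s\<close>. Its terms are polynomials in \<open>s\<close>
  without constant term, so they belong to every subalgebra that contains \<open>s\<close>.\<close>

primrec sqrt_approx :: "'a::f_algebra \<Rightarrow> nat \<Rightarrow> 'a" where
  "sqrt_approx s 0 = 0"
| "sqrt_approx s (Suc n) = sqrt_approx s n + (1/2) *\<^sub>R (s - sqrt_approx s n * sqrt_approx s n)"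

locale unital_f_algebra =
  fixes e :: "'a::f_algebra"
  assumes unit_left: "e * x = x" and unit_right: "x * e = x"
    and order_unit: "strong_order_unit e"
begin

lemma e_nonneg: "0 \<le> e"
  by (rule unit_nonneg[OF unit_left unit_right])

lemma order_unit_bound:
  obtains c where "0 < c" "\<bar>x\<bar> \<le> c *\<^sub>R e"
proof -
  obtain c where c: "0 \<le> c" "\<bar>x\<bar> \<le> c *\<^sub>R \<bar>e\<bar>"
    using order_unit by (auto simp: strong_order_unit_def)
  have "\<bar>x\<bar> \<le> c *\<^sub>R e" using c(2) e_nonneg by simp
  also have "\<dots> \<le> (c + 1) *\<^sub>R e" using e_nonneg by (intro scaleR_right_mono) auto
  finally show thesis using that[of "c + 1"] c(1) by simp
qed

text \<open>The powers \<open>w ^ n\<close> for which \<open>e\<close> is the empty product.\<close>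

primrec unit_power :: "'a \<Rightarrow> nat \<Rightarrow> 'a" where
  "unit_power w 0 = e"
| "unit_power w (Suc n) = unit_power w n * w"

definition uniformly_closed :: "'a set \<Rightarrow> bool" where
  "uniformly_closed S \<longleftrightarrow> (\<forall>z. (\<forall>\<epsilon>>0. \<exists>s\<in>S. \<bar>z - s\<bar> \<le> \<epsilon> *\<^sub>R e) \<longrightarrow> z \<in> S)"

lemma in_order_unit_closure_iff:
  "x \<in> order_unit_topology e closure_of B \<longleftrightarrow> (\<forall>\<epsilon>>0. \<exists>b\<in>B. \<bar>x - b\<bar> \<le> \<epsilon> *\<^sub>R e)"
proof -
  interpret M: Metric_space UNIV "order_unit_dist e"
    by (rule Metric_space_order_unit_dist[OF order_unit e_nonneg])
  have "x \<in> order_unit_topology e closure_of B \<longleftrightarrow>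
      (\<forall>\<epsilon>>0. \<exists>b\<in>B. order_unit_dist e x b < \<epsilon>)"
    by (auto simp: order_unit_topology_def M.metric_closure_of M.in_mball)
  also have "\<dots> \<longleftrightarrow> (\<forall>\<epsilon>>0. \<exists>b\<in>B. \<bar>x - b\<bar> \<le> \<epsilon> *\<^sub>R e)"
  proof (intro iffI allI impI)
    fix \<epsilon> :: real assume "0 < \<epsilon>" "\<forall>\<epsilon>>0. \<exists>b\<in>B. order_unit_dist e x b < \<epsilon>"
    then obtain b where b: "b \<in> B" "order_unit_norm e (x - b) < \<epsilon>"
      by (auto simp: order_unit_dist_def)
    have "\<bar>x - b\<bar> \<le> order_unit_norm e (x - b) *\<^sub>R e"
      by (rule order_unit_norm_bound[OF order_unit e_nonneg])
    also have "\<dots> \<le> \<epsilon> *\<^sub>R e" using b(2) e_nonneg by (intro scaleR_right_mono) auto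
    finally show "\<exists>b\<in>B. \<bar>x - b\<bar> \<le> \<epsilon> *\<^sub>R e" using b(1) by blast
  next
    fix \<epsilon> :: real assume *: "0 < \<epsilon>" "\<forall>\<epsilon>>0. \<exists>b\<in>B. \<bar>x - b\<bar> \<le> \<epsilon> *\<^sub>R e"
    then obtain b where b: "b \<in> B" "\<bar>x - b\<bar> \<le> (\<epsilon>/2) *\<^sub>R e"
      by (meson half_gt_zero)
    then have "order_unit_norm e (x - b) \<le> \<epsilon>/2"
      using *(1) by (intro order_unit_norm_le[OF order_unit e_nonneg]) auto
    then have "order_unit_dist e x b < \<epsilon>" using *(1) by (simp add: order_unit_dist_def)
    then show "\<exists>b\<in>B. order_unit_dist e x b < \<epsilon>" using b(1) by blast
  qed
  finally show ?thesis .
qed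

lemma subset_order_unit_closure: "B \<subseteq> order_unit_topology e closure_of B"
proof
  fix x assume "x \<in> B"
  then show "x \<in> order_unit_topology e closure_of B"
    using e_nonneg by (auto simp: in_order_unit_closure_iff intro!: bexI[of _ x] scaleR_nonneg_nonneg)
qed

lemma uniformly_closed_closure: "uniformly_closed (order_unit_topology e closure_of B)"
  unfolding uniformly_closed_def
proof (intro allI impI)
  fix z assume z: "\<forall>\<epsilon>>0. \<exists>s\<in>order_unit_topology e closure_of B. \<bar>z - s\<bar> \<le> \<epsilon> *\<^sub>R e"
  show "z \<in> order_unit_topology e closure_of B"
    unfolding in_order_unit_closure_iff
  proof (intro allI impI)
    fix \<epsilon> :: real assume \<epsilon>: "0 < \<epsilon>"
    obtain s where s: "s \<in> order_unit_topology e closure_of B" "\<bar>z - s\<bar> \<le> (\<epsilon>/2) *\<^sub>R e"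
      using z \<epsilon> by (meson half_gt_zero)
    obtain b where b: "b \<in> B" "\<bar>s - b\<bar> \<le> (\<epsilon>/2) *\<^sub>R e"
      using s(1) \<epsilon> unfolding in_order_unit_closure_iff by (meson half_gt_zero)
    have "\<bar>z - b\<bar> \<le> \<bar>z - s\<bar> + \<bar>s - b\<bar>" using abs_triangle_ineq[of "z - s" "s - b"] by simp
    also have "\<dots> \<le> (\<epsilon>/2) *\<^sub>R e + (\<epsilon>/2) *\<^sub>R e" by (intro add_mono s b)
    also have "\<dots> = \<epsilon> *\<^sub>R e" by (simp flip: scaleR_add_left)
    finally show "\<exists>b\<in>B. \<bar>z - b\<bar> \<le> \<epsilon> *\<^sub>R e" using b(1) by blast
  qed
qed

lemma subalgebra_closure:
  assumes "subalgebra B"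
  shows "subalgebra (order_unit_topology e closure_of B)"
proof -
  let ?C = "order_unit_topology e closure_of B"
  have sub: "subspace B" and mult: "\<And>x y. x \<in> B \<Longrightarrow> y \<in> B \<Longrightarrow> x * y \<in> B"
    using assms by (auto simp: subalgebra_def)
  have zero: "0 \<in> ?C" using subset_order_unit_closure subspace_0[OF sub] by blast
  have add: "x + y \<in> ?C" if x: "x \<in> ?C" and y: "y \<in> ?C" for x y
    unfolding in_order_unit_closure_iff
  proof (intro allI impI)
    fix \<epsilon> :: real assume "0 < \<epsilon>"
    then have h: "0 < \<epsilon>/2" by simp
    obtain a where a: "a \<in> B" "\<bar>x - a\<bar> \<le> (\<epsilon>/2) *\<^sub>R e" using x h in_order_unit_closure_iff by blast
    obtain b where b: "b \<in> B" "\<bar>y - b\<bar> \<le> (\<epsilon>/2) *\<^sub>R e" using y h in_order_unit_closure_iff by blast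
    have "\<bar>x + y - (a + b)\<bar> \<le> \<bar>x - a\<bar> + \<bar>y - b\<bar>"
      using abs_triangle_ineq[of "x - a" "y - b"] by (simp add: algebra_simps)
    also have "\<dots> \<le> (\<epsilon>/2) *\<^sub>R e + (\<epsilon>/2) *\<^sub>R e" by (intro add_mono a b)
    also have "\<dots> = \<epsilon> *\<^sub>R e" by (simp flip: scaleR_add_left)
    finally show "\<exists>b\<in>B. \<bar>x + y - b\<bar> \<le> \<epsilon> *\<^sub>R e" using a(1) b(1) subspace_add[OF sub] by blast
  qed
  have prod: "x * y \<in> ?C" if x: "x \<in> ?C" and y: "y \<in> ?C" for x y
    unfolding in_order_unit_closure_iff
  proof (intro allI impI)
    fix \<epsilon> :: real assume \<epsilon>: "0 < \<epsilon>"
    obtain k where k: "0 < k" "\<bar>y\<bar> \<le> k *\<^sub>R e" by (rule order_unit_bound)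
    have "0 < \<epsilon>/(2*k)" using \<epsilon> k by simp
    then obtain a where a: "a \<in> B" "\<bar>x - a\<bar> \<le> (\<epsilon>/(2*k)) *\<^sub>R e"
      using x in_order_unit_closure_iff by blast
    obtain l where l: "0 < l" "\<bar>a\<bar> \<le> l *\<^sub>R e" by (rule order_unit_bound)
    have "0 < \<epsilon>/(2*l)" using \<epsilon> l by simp
    then obtain b where b: "b \<in> B" "\<bar>y - b\<bar> \<le> (\<epsilon>/(2*l)) *\<^sub>R e"
      using y in_order_unit_closure_iff by blast
    have "x * y - a * b = (x - a) * y + a * (y - b)" by (simp add: algebra_simps)
    then have "\<bar>x * y - a * b\<bar> \<le> \<bar>(x - a) * y\<bar> + \<bar>a * (y - b)\<bar>"
      using abs_triangle_ineq by metis
    also have "\<dots> \<le> \<bar>x - a\<bar> * \<bar>y\<bar> + \<bar>a\<bar> * \<bar>y - b\<bar>"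
      by (intro add_mono abs_le_mult)
    also have "\<dots> \<le> (\<epsilon>/(2*k)) *\<^sub>R e * (k *\<^sub>R e) + l *\<^sub>R e * ((\<epsilon>/(2*l)) *\<^sub>R e)"
      using \<epsilon> k l e_nonneg by (intro add_mono mult_mono a b k(2) l(2) scaleR_nonneg_nonneg abs_ge_zero) auto
    also have "\<dots> = \<epsilon> *\<^sub>R e"
      using k(1) l(1) by (simp add: unit_left flip: scaleR_add_left)
    finally show "\<exists>b\<in>B. \<bar>x * y - b\<bar> \<le> \<epsilon> *\<^sub>R e" using a(1) b(1) mult by blast
  qed
  have scale: "c *\<^sub>R x \<in> ?C" if x: "x \<in> ?C" for c x
    unfolding in_order_unit_closure_iff
  proof (intro allI impI)
    fix \<epsilon> :: real assume \<epsilon>: "0 < \<epsilon>"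
    then have "0 < \<epsilon>/(\<bar>c\<bar> + 1)" by simp
    then obtain a where a: "a \<in> B" "\<bar>x - a\<bar> \<le> (\<epsilon>/(\<bar>c\<bar> + 1)) *\<^sub>R e"
      using x in_order_unit_closure_iff by blast
    have "\<bar>c *\<^sub>R x - c *\<^sub>R a\<bar> = \<bar>(c *\<^sub>R e) * (x - a)\<bar>"
      by (simp add: unit_left algebra_simps)
    also have "\<dots> \<le> \<bar>c *\<^sub>R e\<bar> * \<bar>x - a\<bar>" by (rule abs_le_mult)
    also have "\<dots> \<le> (\<bar>c\<bar> *\<^sub>R e) * ((\<epsilon>/(\<bar>c\<bar> + 1)) *\<^sub>R e)"
    proof (intro mult_mono a)
      have "c *\<^sub>R e \<le> \<bar>c\<bar> *\<^sub>R e" "(- c) *\<^sub>R e \<le> \<bar>c\<bar> *\<^sub>R e"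
        using e_nonneg by (intro scaleR_right_mono; simp)+
      then show "\<bar>c *\<^sub>R e\<bar> \<le> \<bar>c\<bar> *\<^sub>R e" by (intro abs_leI) auto
    qed (use e_nonneg in \<open>auto intro!: scaleR_nonneg_nonneg\<close>)
    also have "\<dots> = (\<bar>c\<bar> * \<epsilon>/(\<bar>c\<bar> + 1)) *\<^sub>R e" by (simp add: unit_left)
    also have "\<dots> \<le> \<epsilon> *\<^sub>R e"
      using e_nonneg \<epsilon> by (intro scaleR_right_mono) (auto simp: field_simps)
    finally show "\<exists>b\<in>B. \<bar>c *\<^sub>R x - b\<bar> \<le> \<epsilon> *\<^sub>R e"
      using a(1) subspace_scale[OF sub] by blast
  qed
  show ?thesis
    using zero add scale prod unfolding subalgebra_def subspace_def by blast
qed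

text \<open>The terms \<open>(e - b) ^ k * b\<close> are decreasing in \<open>k\<close> and telescope to \<open>e - (e - b) ^ (n + 1)\<close>;
  hence the last of \<open>n + 1\<close> terms is at most \<open>e / (n + 1)\<close>. This bounds the error of the
  square root iteration.\<close>

lemma unit_power_bounds:
  assumes b: "0 \<le> b" "b \<le> e"
  shows "0 \<le> unit_power (e - b) n"
    and "real (Suc n) *\<^sub>R (unit_power (e - b) n * b) \<le> e - unit_power (e - b) (Suc n)"
proof -
  let ?g = "unit_power (e - b)"
  have pos: "0 \<le> ?g n" for n
    by (induction n) (use e_nonneg b in \<open>auto intro: times_nonneg\<close>)
  have step: "?g (Suc n) = ?g n - ?g n * b" for n
    by (simp add: right_diff_distrib unit_right)
  have dec: "?g (Suc n) * b \<le> ?g n * b" for n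
    using times_nonneg[OF pos b(1)] b(1) unfolding step by (intro mult_right_mono) auto
  show "0 \<le> ?g n" by (rule pos)
  show "real (Suc n) *\<^sub>R (?g n * b) \<le> e - ?g (Suc n)"
  proof (induction n)
    case 0
    show ?case by (simp add: unit_left)
  next
    case (Suc n)
    have "real (Suc (Suc n)) *\<^sub>R (?g (Suc n) * b)
        = real (Suc n) *\<^sub>R (?g (Suc n) * b) + ?g (Suc n) * b"
      by (metis add.commute of_nat_Suc scaleR_left_distrib scaleR_one)
    also have "\<dots> \<le> real (Suc n) *\<^sub>R (?g n * b) + ?g (Suc n) * b"
      by (intro add_mono scaleR_left_mono dec) auto
    also have "\<dots> \<le> (e - ?g (Suc n)) + ?g (Suc n) * b"
      by (intro add_mono Suc.IH order_refl)
    also have "\<dots> = e - ?g (Suc (Suc n))"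
      unfolding step[of "Suc n"] by (simp only: diff_diff_eq2 diff_add_eq)
    finally show ?case .
  qed
qed

text \<open>The error satisfies \<open>a - y (n+1) = (a - y n) * (e - (a + y n) / 2)\<close>, and the last factor is at
  most \<open>e - a / 2\<close>. Commutation of \<open>a\<close> with \<open>y n\<close>, needed for this factorization, is carried
  through the induction.\<close>

lemma sqrt_approx_bounds:
  assumes a: "0 \<le> a" "a \<le> e"
  defines "y \<equiv> sqrt_approx (a * a)" and "w \<equiv> e - (1/2) *\<^sub>R a"
  shows "a * y n = y n * a \<and> 0 \<le> y n \<and> y n \<le> a \<and> a - y n \<le> unit_power w n * a"
proof (induction n)
  case 0
  show ?case using a by (simp add: y_def unit_left)
next
  case (Suc n)
  let ?d = "a - y n"
  have comm: "a * y n = y n * a" and y: "0 \<le> y n" "y n \<le> a" and d: "?d \<le> unit_power w n * a"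
    using Suc.IH by auto
  have ySuc: "y (Suc n) = y n + (1/2) *\<^sub>R (a * a - y n * y n)" by (simp add: y_def)
  have "a * (y n * y n) = y n * y n * a"
    by (metis comm mult.assoc)
  then have 1: "a * y (Suc n) = y (Suc n) * a"
    by (simp add: ySuc algebra_simps comm mult.assoc)
  have "y n * y n \<le> a * a" using y a by (intro mult_mono) auto
  then have "0 \<le> (1/2) *\<^sub>R (a * a - y n * y n)" by (intro scaleR_nonneg_nonneg) auto
  then have 2: "0 \<le> y (Suc n)" using y by (simp add: ySuc)
  have fact: "a - y (Suc n) = ?d * (e - (1/2) *\<^sub>R (a + y n))"
    by (simp add: ySuc algebra_simps comm unit_right)
  have "(1/2) *\<^sub>R (a + y n) \<le> (1/2) *\<^sub>R (e + e)"
    using a y by (intro scaleR_left_mono add_mono) auto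
  also have "\<dots> = e" by (simp flip: scaleR_2)
  finally have "0 \<le> ?d * (e - (1/2) *\<^sub>R (a + y n))"
    using y by (intro times_nonneg) auto
  then have 3: "y (Suc n) \<le> a" by (simp only: fact[symmetric] diff_ge_0_iff_ge)
  have w0: "0 \<le> w"
  proof -
    have "(1/2) *\<^sub>R a \<le> 1 *\<^sub>R a" using a by (intro scaleR_right_mono) auto
    then show ?thesis using a by (simp add: w_def)
  qed
  have "(1/2) *\<^sub>R y n \<ge> 0" using y by (intro scaleR_nonneg_nonneg) auto
  then have "e - (1/2) *\<^sub>R (a + y n) \<le> w" by (simp add: w_def scaleR_right_distrib)
  then have "a - y (Suc n) \<le> ?d * w"
    unfolding fact using y by (intro mult_left_mono) auto
  also have "\<dots> \<le> unit_power w n * a * w" using d w0 by (rule mult_right_mono)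
  also have "a * w = w * a" by (simp add: w_def algebra_simps unit_left unit_right)
  then have "unit_power w n * a * w = unit_power w (Suc n) * a" by (simp add: mult.assoc)
  finally show ?case using 1 2 3 by blast
qed

text \<open>After scaling to \<open>a = \<bar>x\<bar> / c \<le> e\<close>, the iterates for the square root of \<open>a * a = (x / c)\<^sup>2\<close>
  lie in the subalgebra, and with \<open>b = a / 2\<close> the two preceding lemmas bound their distance to
  \<open>a\<close> by \<open>2 e / (n + 1)\<close>.\<close>

lemma abs_mem:
  assumes "subalgebra S" "uniformly_closed S" "x \<in> S"
  shows "\<bar>x\<bar> \<in> S"
proof -
  have sub: "subspace S" and mult: "\<And>x y. x \<in> S \<Longrightarrow> y \<in> S \<Longrightarrow> x * y \<in> S"
    using assms by (auto simp: subalgebra_def)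
  obtain c where c: "0 < c" "\<bar>x\<bar> \<le> c *\<^sub>R e" by (rule order_unit_bound)
  define a where "a = inverse c *\<^sub>R \<bar>x\<bar>"
  have "inverse c *\<^sub>R \<bar>x\<bar> \<le> inverse c *\<^sub>R (c *\<^sub>R e)" using c by (intro scaleR_left_mono) auto
  then have a: "0 \<le> a" "a \<le> e" using c by (auto simp: a_def intro: scaleR_nonneg_nonneg)
  have "a * a = (inverse c *\<^sub>R x) * (inverse c *\<^sub>R x)"
    by (simp add: a_def abs_mult_abs_self)
  then have aa: "a * a \<in> S" by (simp only: mult subspace_scale[OF sub assms(3)])
  have yS: "sqrt_approx (a * a) n \<in> S" for n
  proof (induction n)
    case 0
    show ?case by (simp add: subspace_0[OF sub])
  next
    case (Suc n)
    show ?case unfolding sqrt_approx.simps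
      by (rule subspace_add[OF sub Suc.IH subspace_scale[OF sub subspace_diff[OF sub aa mult[OF Suc.IH Suc.IH]]]])
  qed
  have "a \<in> S"
  proof -
    have "\<exists>s\<in>S. \<bar>a - s\<bar> \<le> \<epsilon> *\<^sub>R e" if "0 < \<epsilon>" for \<epsilon> :: real
    proof -
      have "0 < \<epsilon>/2" using that by simp
      then obtain n where n: "inverse (real (Suc n)) < \<epsilon>/2"
        using reals_Archimedean by blast
      define b where "b = (1/2) *\<^sub>R a"
      have "(1/2) *\<^sub>R a \<le> 1 *\<^sub>R a" using a by (intro scaleR_right_mono) auto
      then have b: "0 \<le> b" "b \<le> e" using a by (auto simp: b_def intro: scaleR_nonneg_nonneg)
      let ?g = "unit_power (e - b)" and ?y = "sqrt_approx (a * a) n"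
      have "real (Suc n) *\<^sub>R (?g n * b) \<le> e - ?g (Suc n)" by (rule unit_power_bounds(2)[OF b])
      also have "\<dots> \<le> e" using unit_power_bounds(1)[OF b, of "Suc n"] by simp
      finally have "inverse (real (Suc n)) *\<^sub>R (real (Suc n) *\<^sub>R (?g n * b)) \<le> inverse (real (Suc n)) *\<^sub>R e"
        by (intro scaleR_left_mono) auto
      then have gb: "?g n * b \<le> inverse (real (Suc n)) *\<^sub>R e" by simp
      have ab: "a = b + b" by (simp add: b_def flip: scaleR_2)
      have bd: "?y \<le> a" "a - ?y \<le> ?g n * a"
        using sqrt_approx_bounds[OF a, of n] by (auto simp: b_def)
      have "\<bar>a - ?y\<bar> = a - ?y" using bd(1) by simp
      also have "\<dots> \<le> ?g n * b + ?g n * b" using bd(2) ab by (metis distrib_left)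
      also have "\<dots> \<le> inverse (real (Suc n)) *\<^sub>R e + inverse (real (Suc n)) *\<^sub>R e"
        by (intro add_mono gb)
      also have "\<dots> = (2 * inverse (real (Suc n))) *\<^sub>R e" by (simp flip: scaleR_add_left)
      also have "\<dots> \<le> \<epsilon> *\<^sub>R e" using n e_nonneg by (intro scaleR_right_mono) auto
      finally show ?thesis using yS by blast
    qed
    then show ?thesis using assms(2) unfolding uniformly_closed_def by blast
  qed
  then have "c *\<^sub>R a \<in> S" by (rule subspace_scale[OF sub])
  then show ?thesis using c by (simp add: a_def)
qed

text \<open>A multiple \<open>v\<close> of \<open>\<bar>u\<bar>\<close> satisfies \<open>\<delta> e \<le> v \<le> e\<close> for some \<open>\<delta> > 0\<close>. Then \<open>(e - v) ^ n\<close> is at most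
  \<open>(1 - \<delta>) ^ n e\<close>, while \<open>e - (e - v) ^ n\<close> is a polynomial in \<open>v\<close> without constant term.\<close>

lemma unit_mem:
  assumes S: "subalgebra S" "uniformly_closed S" and u: "u \<in> S" "strong_order_unit u"
  shows "e \<in> S"
proof -
  have sub: "subspace S" and mult: "\<And>x y. x \<in> S \<Longrightarrow> y \<in> S \<Longrightarrow> x * y \<in> S"
    using assms by (auto simp: subalgebra_def)
  obtain m where m: "0 < m" "\<bar>u\<bar> \<le> m *\<^sub>R e" by (rule order_unit_bound)
  obtain c where c: "0 \<le> c" "\<bar>e\<bar> \<le> c *\<^sub>R \<bar>u\<bar>"
    using u(2) by (auto simp: strong_order_unit_def)
  define v where "v = inverse m *\<^sub>R \<bar>u\<bar>"
  have vS: "v \<in> S" unfolding v_def by (intro subspace_scale[OF sub] abs_mem S u)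
  have "inverse m *\<^sub>R \<bar>u\<bar> \<le> inverse m *\<^sub>R (m *\<^sub>R e)" using m by (intro scaleR_left_mono) auto
  then have v: "0 \<le> v" "v \<le> e" using m by (auto simp: v_def intro: scaleR_nonneg_nonneg)
  \<comment> \<open>Here \<open>e \<le> c m v\<close>; the summand \<open>1\<close> ensures \<open>\<delta> \<le> 1\<close>, also when \<open>c = 0\<close>.\<close>
  define \<delta> where "\<delta> = inverse (c * m + 1)"
  have cm: "0 \<le> c * m" using c m by simp
  then have \<delta>: "0 < \<delta>" "\<delta> \<le> 1" by (auto simp: \<delta>_def inverse_le_1_iff)
  have "e \<le> (c * m) *\<^sub>R v" using c e_nonneg m by (simp add: v_def mult.assoc)
  also have "\<dots> \<le> (c * m + 1) *\<^sub>R v" using v by (intro scaleR_right_mono) auto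
  finally have "\<delta> *\<^sub>R e \<le> \<delta> *\<^sub>R ((c * m + 1) *\<^sub>R v)" using \<delta> by (intro scaleR_left_mono) auto
  then have \<delta>v: "\<delta> *\<^sub>R e \<le> v" using cm by (simp add: \<delta>_def)
  let ?g = "unit_power (e - v)"
  have gS: "e - ?g n \<in> S" for n
  proof (induction n)
    case 0
    show ?case by (simp add: subspace_0[OF sub])
  next
    case (Suc n)
    have "e - ?g (Suc n) = (e - ?g n) + v - (e - ?g n) * v"
      by (simp add: algebra_simps unit_left unit_right)
    then show ?case
      using subspace_diff[OF sub subspace_add[OF sub Suc.IH vS] mult[OF Suc.IH vS]] by (simp only:)
  qed
  have g_le: "?g n \<le> (1 - \<delta>) ^ n *\<^sub>R e" for n
  proof (induction n)
    case 0
    show ?case by simp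
  next
    case (Suc n)
    have "e - v \<le> (1 - \<delta>) *\<^sub>R e" using \<delta>v by (simp add: scaleR_left_diff_distrib)
    then have "?g n * (e - v) \<le> (1 - \<delta>) ^ n *\<^sub>R e * ((1 - \<delta>) *\<^sub>R e)"
      using Suc.IH v \<delta> e_nonneg by (intro mult_mono) (auto intro: scaleR_nonneg_nonneg)
    then show ?case by (simp add: unit_left mult.commute)
  qed
  have "\<exists>s\<in>S. \<bar>e - s\<bar> \<le> \<epsilon> *\<^sub>R e" if "0 < \<epsilon>" for \<epsilon> :: real
  proof -
    have "1 - \<delta> < 1" using \<delta> by simp
    then obtain n where n: "(1 - \<delta>) ^ n < \<epsilon>" using real_arch_pow_inv[OF \<open>0 < \<epsilon>\<close>] by blast
    have "\<bar>e - (e - ?g n)\<bar> = ?g n" using unit_power_bounds(1)[OF v] by simp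
    also have "\<dots> \<le> (1 - \<delta>) ^ n *\<^sub>R e" by (rule g_le)
    also have "\<dots> \<le> \<epsilon> *\<^sub>R e" using n e_nonneg by (intro scaleR_right_mono) auto
    finally show ?thesis using gS by blast
  qed
  then show ?thesis using S(2) unfolding uniformly_closed_def by blast
qed

lemma sup_inf_mem:
  assumes S: "subalgebra S" "uniformly_closed S" and xy: "x \<in> S" "y \<in> S"
  shows "sup x y \<in> S" "inf x y \<in> S"
proof -
  have sub: "subspace S" using S by (auto simp: subalgebra_def)
  have sup: "sup x y \<in> S" if "x \<in> S" "y \<in> S" for x y
  proof -
    have "(p - n) + (p + n) = 2 *\<^sub>R p" for p n :: 'a by (simp add: scaleR_2)
    from this[of "pprt (x - y)" "nprt (x - y)"]
    have "\<bar>x - y\<bar> + (x - y) = 2 *\<^sub>R pprt (x - y)"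
      by (simp only: abs_prts[symmetric] prts[symmetric])
    then have "pprt (x - y) = (1/2) *\<^sub>R (\<bar>x - y\<bar> + (x - y))" by simp
    moreover have "sup x y = pprt (x - y) + y" by (simp add: pprt_def add_sup_distrib_right)
    ultimately show ?thesis
      using abs_mem[OF S] that by (auto intro!: subspace_add subspace_scale subspace_diff sub)
  qed
  show "sup x y \<in> S" using sup xy by blast
  have "inf x y = - sup (- x) (- y)" by (simp only: inf_eq_neg_sup)
  then show "inf x y \<in> S" using sup[of "- x" "- y"] xy subspace_neg[OF sub] by (simp only:)
qed

end

section \<open>Neighbourhoods of zero in a uo-Lebesgue topology\<close>

definition nbhd0 :: "'a::zero topology \<Rightarrow> 'a set \<Rightarrow> bool" where
  "nbhd0 T V \<longleftrightarrow> (\<exists>U. openin T U \<and> 0 \<in> U \<and> U \<subseteq> V)"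

lemma nbhd0_Int: "nbhd0 T U \<Longrightarrow> nbhd0 T V \<Longrightarrow> nbhd0 T (U \<inter> V)"
  unfolding nbhd0_def by (metis IntI Int_mono openin_Int)

lemma nbhd0_zero: "nbhd0 T V \<Longrightarrow> 0 \<in> V"
  by (auto simp: nbhd0_def)

lemma openin_translate:
  assumes "linear_topology T" "openin T U"
  shows "openin T {y. y + a \<in> U}"
proof -
  have top: "topspace T = UNIV" and add: "continuous_map (prod_topology T T) T (\<lambda>(x, y). x + y)"
    using assms(1) by (auto simp: linear_topology_def)
  have "continuous_map T (prod_topology T T) (\<lambda>y. (y, a))"
    using top by (intro continuous_map_pairedI continuous_map_id[unfolded id_def]) auto
  from continuous_map_compose[OF this add] have "continuous_map T T (\<lambda>y. y + a)"
    by (simp add: o_def)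
  from openin_continuous_map_preimage[OF this assms(2)] show ?thesis
    using top by simp
qed

lemma nbhd0_half:
  assumes T: "linear_topology T" "locally_solid T" and U: "nbhd0 T U"
  obtains V where "nbhd0 T V" "solid V" "\<forall>x\<in>V. \<forall>y\<in>V. x + y \<in> U"
proof -
  have top: "topspace T = UNIV" and add: "continuous_map (prod_topology T T) T (\<lambda>(x, y). x + y)"
    using T(1) by (auto simp: linear_topology_def)
  obtain O' where O': "openin T O'" "0 \<in> O'" "O' \<subseteq> U" using U by (auto simp: nbhd0_def)
  have "openin (prod_topology T T) {p. fst p + snd p \<in> O'}"
    using openin_continuous_map_preimage[OF add O'(1)] top by (simp add: split_def)
  moreover have "(0, 0) \<in> {p. fst p + snd p \<in> O'}" using O' by simp
  ultimately obtain G H where GH: "openin T G" "openin T H" "0 \<in> G" "0 \<in> H"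
      "G \<times> H \<subseteq> {p. fst p + snd p \<in> O'}"
    unfolding openin_prod_topology_alt by meson
  have "openin T (G \<inter> H)" "0 \<in> G \<inter> H" using GH by auto
  then obtain W V where V: "openin T W" "0 \<in> W" "W \<subseteq> V" "V \<subseteq> G \<inter> H" "solid V"
    using T(2) unfolding locally_solid_def by meson
  show thesis
  proof
    show "nbhd0 T V" using V by (auto simp: nbhd0_def)
    show "solid V" by fact
    show "\<forall>x\<in>V. \<forall>y\<in>V. x + y \<in> U"
    proof (intro ballI)
      fix x y assume that: "x \<in> V" "y \<in> V"
      have "(x, y) \<in> G \<times> H" using that V by blast
      then have "(x, y) \<in> {p. fst p + snd p \<in> O'}" using GH(5) by blast
      then show "x + y \<in> U" using O'(3) by auto
    qed
  qed
qed

lemma closure_of_nbhd0: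
  assumes T: "linear_topology T" and x: "x \<in> T closure_of S" and V: "nbhd0 T V"
  shows "\<exists>s\<in>S. s - x \<in> V"
proof -
  obtain U where U: "openin T U" "0 \<in> U" "U \<subseteq> V" using V by (auto simp: nbhd0_def)
  have "openin T {y. y + (- x) \<in> U}" by (rule openin_translate[OF T U(1)])
  moreover have "x \<in> {y. y + (- x) \<in> U}" using U by simp
  moreover have "\<forall>G. x \<in> G \<and> openin T G \<longrightarrow> (\<exists>y. y \<in> S \<and> y \<in> G)"
    using x by (simp add: in_closure_of)
  ultimately have "\<exists>y. y \<in> S \<and> y \<in> {y. y + (- x) \<in> U}" by meson
  then show ?thesis using U(3) by auto
qed

lemma Hausdorff_nbhd0_eq_0:
  assumes T: "linear_topology T" "Hausdorff_space T" and x: "\<And>V. nbhd0 T V \<Longrightarrow> x \<in> V"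
  shows "x = 0"
proof (rule ccontr)
  assume "x \<noteq> 0"
  then obtain U W where "openin T U" "openin T W" "0 \<in> U" "x \<in> W" "disjnt U W"
    using T unfolding Hausdorff_space_def linear_topology_def by (metis UNIV_I)
  moreover have "x \<in> U" using x[of U] calculation by (auto simp: nbhd0_def)
  ultimately show False by (auto simp: disjnt_def)
qed

lemma small_multiple_in_nbhd0:
  assumes T: "linear_topology T" and V: "nbhd0 T V"
  obtains c :: real where "0 < c" "c \<le> 1" "c *\<^sub>R x \<in> V"
proof -
  have top: "topspace T = UNIV"
    and scale: "continuous_map (prod_topology euclideanreal T) T (\<lambda>(c, x). c *\<^sub>R x)"
    using T by (auto simp: linear_topology_def)
  obtain U where U: "openin T U" "0 \<in> U" "U \<subseteq> V" using V by (auto simp: nbhd0_def)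
  have "continuous_map euclideanreal (prod_topology euclideanreal T) (\<lambda>c. (c, x))"
    using top by (intro continuous_map_pairedI continuous_map_id[unfolded id_def]) auto
  from continuous_map_compose[OF this scale]
  have "continuous_map euclideanreal T (\<lambda>c. c *\<^sub>R x)" by (simp add: o_def)
  from openin_continuous_map_preimage[OF this U(1)] have "open {c. c *\<^sub>R x \<in> U}"
    by simp
  moreover have "0 \<in> {c. c *\<^sub>R x \<in> U}" using U by simp
  ultimately obtain \<epsilon> where \<epsilon>: "0 < \<epsilon>" "ball 0 \<epsilon> \<subseteq> {c. c *\<^sub>R x \<in> U}"
    by (meson open_contains_ball)
  have "min 1 (\<epsilon>/2) \<in> ball 0 \<epsilon>" using \<epsilon>(1) by simp
  then have "min 1 (\<epsilon>/2) *\<^sub>R x \<in> V" using \<epsilon>(2) U(3) by blast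
  then show thesis using \<epsilon>(1) by (intro that[of "min 1 (\<epsilon>/2)"]) auto
qed

section \<open>Order convergence and uo-Lebesgue topologies\<close>

lemma isLub_UNIV_iff:
  "isLub UNIV S (s::'a::order) \<longleftrightarrow> (\<forall>a\<in>S. a \<le> s) \<and> (\<forall>u. (\<forall>a\<in>S. a \<le> u) \<longrightarrow> s \<le> u)"
  by (auto simp: isLub_def leastP_def isUb_def setle_def setge_def)

lemma isGlb_UNIV_iff:
  "isGlb UNIV S (s::'a::order) \<longleftrightarrow> (\<forall>a\<in>S. s \<le> a) \<and> (\<forall>u. (\<forall>a\<in>S. u \<le> a) \<longrightarrow> u \<le> s)"
  by (auto simp: isGlb_def greatestP_def isLb_def setle_def setge_def)

lemma order_conv_imp_uo_conv:
  assumes "order_conv A r f x"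
  shows "uo_conv A r f x"
  unfolding uo_conv_def
proof (intro allI impI)
  fix w :: 'b assume w: "0 \<le> w"
  obtain D s y where y: "decreases_to_0 (D::'b set) s y"
      "\<And>b. b \<in> D \<Longrightarrow> eventually_net A r (\<lambda>a. \<bar>x - f a\<bar> \<le> y b)"
    using assms unfolding order_conv_def by blast
  show "order_conv A r (\<lambda>a. inf \<bar>f a - x\<bar> w) 0"
  proof (rule order_convI[OF y(1)])
    fix b assume "b \<in> D"
    have "\<bar>0 - inf \<bar>f a - x\<bar> w\<bar> \<le> y b" if "\<bar>x - f a\<bar> \<le> y b" for a
    proof -
      have "\<bar>0 - inf \<bar>f a - x\<bar> w\<bar> = inf \<bar>f a - x\<bar> w" using w by simp
      also have "\<dots> \<le> \<bar>f a - x\<bar>" by simp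
      also have "\<dots> \<le> y b" using that by (simp add: abs_minus_commute)
      finally show ?thesis .
    qed
    then show "eventually_net A r (\<lambda>a. \<bar>0 - inf \<bar>f a - x\<bar> w\<bar> \<le> y b)"
      using y(2)[OF \<open>b \<in> D\<close>] unfolding eventually_net_def by blast
  qed
qed

lemma uo_adherence_subset_closure:
  assumes T: "uo_Lebesgue T"
  shows "uo_adherence S \<subseteq> T closure_of S"
proof
  fix x assume "x \<in> uo_adherence S"
  then obtain A :: "('a set \<times> 'a) set" and r f where
    f: "directed A r" "f ` A \<subseteq> S" "uo_conv A r f x" by (auto simp: uo_adherence_def)
  have lin: "linear_topology T" using T by (simp add: uo_Lebesgue_def)
  have "uo_conv A r (\<lambda>a. f a - x) 0" using f(3) by (simp add: uo_conv_def)
  then have conv: "topology_conv T A r (\<lambda>a. f a - x) 0" by (rule uo_LebesgueD[OF T f(1)])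
  show "x \<in> T closure_of S"
    unfolding in_closure_of
  proof (intro conjI allI impI)
    show "x \<in> topspace T" using lin by (simp add: linear_topology_def)
    fix U assume U: "x \<in> U \<and> openin T U"
    have "openin T {y. y + x \<in> U}" using openin_translate[OF lin] U by blast
    then obtain a where a: "a \<in> A" "\<forall>b\<in>A. r a b \<longrightarrow> f b - x + x \<in> U"
      using conv U unfolding topology_conv_def eventually_net_def by auto
    have "r a a" using f(1) a(1) by (auto simp: directed_def reflp_on_def)
    then show "\<exists>y. y \<in> S \<and> y \<in> U" using a f(2) by auto
  qed
qed

lemma directed_nat: "directed (UNIV :: nat set) (\<le>)"
proof -
  have "\<exists>c. a \<le> c \<and> b \<le> c" for a b :: nat by (rule exI[of _ "max a b"]) simp
  then show ?thesis by (auto simp: directed_def reflp_on_def transp_on_def)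
qed

lemma adherence_inclusions:
  "sigma_o_adherence S \<subseteq> o_adherence S"
  "sigma_o_adherence S \<subseteq> sigma_uo_adherence S"
  "o_adherence S \<subseteq> uo_adherence S"
  "sigma_uo_adherence S \<subseteq> uo_adherence S"
proof -
  show "sigma_o_adherence S \<subseteq> o_adherence S"
    using o_adherenceI[OF directed_nat] by (auto simp: sigma_o_adherence_def)
  show "sigma_uo_adherence S \<subseteq> uo_adherence S"
    using uo_adherenceI[OF directed_nat] by (auto simp: sigma_uo_adherence_def)
  show "sigma_o_adherence S \<subseteq> sigma_uo_adherence S"
    using order_conv_imp_uo_conv unfolding sigma_o_adherence_def sigma_uo_adherence_def by blast
  show "o_adherence S \<subseteq> uo_adherence S"
    using order_conv_imp_uo_conv unfolding o_adherence_def uo_adherence_def by blast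
qed

lemma sigma_o_adherence_mono: "S \<subseteq> S' \<Longrightarrow> sigma_o_adherence S \<subseteq> sigma_o_adherence S'"
  unfolding sigma_o_adherence_def by blast

lemma decreases_to_0_imp_order_conv:
  assumes "decreases_to_0 A r y"
  shows "order_conv A r y 0"
proof (rule order_convI[OF assms])
  have nonneg: "0 \<le> y a" if "a \<in> A" for a
    using assms that by (auto simp: decreases_to_0_def isGlb_UNIV_iff)
  fix b assume b: "b \<in> A"
  have "\<bar>0 - y a\<bar> \<le> y b" if "a \<in> A" "r b a" for a
    using assms b that nonneg[OF that(1)] by (simp add: decreases_to_0_def)
  then show "eventually_net A r (\<lambda>a. \<bar>0 - y a\<bar> \<le> y b)"
    using b by (auto simp: eventually_net_def)
qed

text \<open>Indexed by the upward directed set \<open>D\<close> itself, the differences \<open>s - a\<close> decrease to \<open>0\<close>, hence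
  converge to \<open>0\<close> in \<open>T\<close>. In the form of approximation by a single element this gives
  that a supremum belongs to a slightly larger neighbourhood than the elements of \<open>D\<close>.\<close>

lemma isLub_nbhd0:
  assumes T: "uo_Lebesgue T" and D: "D \<noteq> {}" "\<And>a b. a \<in> D \<Longrightarrow> b \<in> D \<Longrightarrow> \<exists>c\<in>D. a \<le> c \<and> b \<le> c"
    and s: "isLub UNIV D s" and V: "nbhd0 T V"
  shows "\<exists>a\<in>D. s - a \<in> V"
proof -
  have ub: "a \<le> s" if "a \<in> D" for a using s that by (auto simp: isLub_UNIV_iff)
  have least: "s \<le> u" if "\<And>a. a \<in> D \<Longrightarrow> a \<le> u" for u
    using s that by (auto simp: isLub_UNIV_iff)
  have dir: "directed D (\<le>)"
    using D by (auto simp: directed_def reflp_on_def transp_on_def)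
  have "isGlb UNIV ((\<lambda>a. s - a) ` D) 0"
    unfolding isGlb_UNIV_iff
  proof (intro conjI ballI allI impI)
    fix y assume "y \<in> (\<lambda>a. s - a) ` D"
    then show "0 \<le> y" using ub by auto
  next
    fix q assume "\<forall>z\<in>(\<lambda>a. s - a) ` D. q \<le> z"
    then have "a \<le> s - q" if "a \<in> D" for a using that by (auto simp: algebra_simps)
    then have "s \<le> s - q" by (rule least)
    then show "q \<le> 0" by simp
  qed
  then have dec: "decreases_to_0 D (\<le>) (\<lambda>a. s - a)"
    using dir by (auto simp: decreases_to_0_def)
  have "topology_conv T D (\<le>) (\<lambda>a. s - a) 0"
    by (rule uo_LebesgueD[OF T dir order_conv_imp_uo_conv[OF decreases_to_0_imp_order_conv[OF dec]]])
  moreover obtain U where U: "openin T U" "0 \<in> U" "U \<subseteq> V" using V by (auto simp: nbhd0_def)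
  ultimately show ?thesis unfolding topology_conv_def eventually_net_def by blast
qed

section \<open>Chains of solid neighbourhoods\<close>

definition nbhd_chain :: "'a::archimedean_vector_lattice topology \<Rightarrow> (nat \<Rightarrow> 'a set) \<Rightarrow> bool" where
  "nbhd_chain T V \<longleftrightarrow> (\<forall>n. nbhd0 T (V n) \<and> solid (V n) \<and>
     (\<forall>x\<in>V (Suc n). \<forall>y\<in>V (Suc n). x + y \<in> V n))"

lemma exists_nbhd_chain:
  assumes T: "linear_topology T" "locally_solid T" and U: "\<And>n. nbhd0 T (U n)"
  obtains V where "nbhd_chain T V" "\<forall>n. V (Suc n) \<subseteq> U n"
proof -
  have "\<exists>V. \<forall>n. (nbhd0 T (V n) \<and> solid (V n)) \<and>
      ((\<forall>x\<in>V (Suc n). \<forall>y\<in>V (Suc n). x + y \<in> V n) \<and> V (Suc n) \<subseteq> U n)"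
  proof (rule dependent_nat_choice)
    obtain V where "nbhd0 T V" "solid V" by (rule nbhd0_half[OF T U[of 0]])
    then show "\<exists>V. nbhd0 T V \<and> solid V" by blast
  next
    fix W n assume W: "nbhd0 T W \<and> solid W"
    obtain V where V: "nbhd0 T V" "solid V" "\<forall>x\<in>V. \<forall>y\<in>V. x + y \<in> W \<inter> U n"
      by (rule nbhd0_half[OF T nbhd0_Int[OF conjunct1[OF W] U[of n]]])
    have "V \<subseteq> U n" using V(3) nbhd0_zero[OF V(1)] by force
    then show "\<exists>V. (nbhd0 T V \<and> solid V) \<and> ((\<forall>x\<in>V. \<forall>y\<in>V. x + y \<in> W) \<and> V \<subseteq> U n)"
      using V by blast
  qed
  then obtain V where "\<forall>n. (nbhd0 T (V n) \<and> solid (V n)) \<and>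
      ((\<forall>x\<in>V (Suc n). \<forall>y\<in>V (Suc n). x + y \<in> V n) \<and> V (Suc n) \<subseteq> U n)" by (rule exE)
  then show thesis by (intro that[of V]) (simp_all add: nbhd_chain_def)
qed

lemma
  assumes "nbhd_chain T V"
  shows nbhd_chain_nbhd0: "nbhd0 T (V n)"
    and nbhd_chain_solid: "y \<in> V n \<Longrightarrow> \<bar>x\<bar> \<le> \<bar>y\<bar> \<Longrightarrow> x \<in> V n"
    and nbhd_chain_add: "a \<in> V (Suc n) \<Longrightarrow> b \<in> V (Suc n) \<Longrightarrow> a + b \<in> V n"
proof -
  show "nbhd0 T (V n)" and "y \<in> V n \<Longrightarrow> \<bar>x\<bar> \<le> \<bar>y\<bar> \<Longrightarrow> x \<in> V n" for n x y
    using assms unfolding nbhd_chain_def solid_def by blast+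
  show "a + b \<in> V n" if "a \<in> V (Suc n)" "b \<in> V (Suc n)" for a b
    using assms that unfolding nbhd_chain_def by blast
qed

lemma nbhd_chain_sum:
  assumes "nbhd_chain T V" "\<And>k. d k \<in> V k"
  shows "(\<Sum>k\<in>{n<..n+j}. d k) \<in> V n"
proof (induction j arbitrary: n)
  case 0
  show ?case using nbhd0_zero[OF nbhd_chain_nbhd0[OF assms(1)]] by simp
next
  case (Suc j)
  have "{n<..n + Suc j} = insert (Suc n) {Suc n<..Suc n + j}" by auto
  then have "(\<Sum>k\<in>{n<..n + Suc j}. d k) = d (Suc n) + (\<Sum>k\<in>{Suc n<..Suc n + j}. d k)" by simp
  then show ?case using nbhd_chain_add[OF assms(1) assms(2)[of "Suc n"] Suc.IH[of "Suc n"]] by simp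
qed

lemma isLub_Sup:
  fixes S :: "'a::conditionally_complete_lattice set"
  assumes "S \<noteq> {}" "bdd_above S"
  shows "isLub UNIV S (Sup S)"
  using assms by (auto simp: isLub_UNIV_iff intro: cSup_upper cSup_least)

text \<open>The intersection of a chain is closed under addition and solid, so its elements in \<open>[0, e]\<close>
  form an upward directed set. Some element \<open>a\<close> of this set has \<open>Sup D - a\<close> in \<open>V (Suc n)\<close>, and
  adding \<open>a \<in> V (Suc n)\<close> shows that the supremum itself lies in \<open>V n\<close>.\<close>

lemma exists_greatest_in_chain_Inter:
  fixes T :: "'a::{archimedean_vector_lattice, conditionally_complete_lattice} topology"
  assumes T: "uo_Lebesgue T" and V: "nbhd_chain T V" and e: "0 \<le> e"
  obtains p where "\<forall>n. p \<in> V n" "\<forall>s. 0 \<le> s \<longrightarrow> s \<le> e \<longrightarrow> (\<forall>n. s \<in> V n) \<longrightarrow> s \<le> p"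
proof -
  define D where "D = {s. 0 \<le> s \<and> s \<le> e \<and> (\<forall>n. s \<in> V n)}"
  have "0 \<in> D" using e nbhd0_zero[OF nbhd_chain_nbhd0[OF V]] by (simp add: D_def)
  then have ne: "D \<noteq> {}" by blast
  have bdd: "bdd_above D" by (auto simp: D_def intro!: bdd_aboveI[of _ e])
  have dir: "\<exists>c\<in>D. a \<le> c \<and> b \<le> c" if ab: "a \<in> D" "b \<in> D" for a b
  proof
    have pos: "0 \<le> a" "0 \<le> b" using ab by (auto simp: D_def)
    have s0: "0 \<le> sup a b" using pos by (simp add: le_supI1)
    have le: "sup a b \<le> a + b" using pos by simp
    have "\<bar>sup a b\<bar> \<le> \<bar>a + b\<bar>" using s0 le pos by simp
    moreover have "a + b \<in> V n" for n using ab nbhd_chain_add[OF V] by (simp add: D_def)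
    ultimately have "sup a b \<in> V n" for n using nbhd_chain_solid[OF V] by blast
    then show "sup a b \<in> D" using ab s0 by (simp add: D_def)
  qed auto
  show thesis
  proof (rule that; intro allI impI)
    fix n
    obtain a where a: "a \<in> D" "Sup D - a \<in> V (Suc n)"
      using isLub_nbhd0[OF T ne dir isLub_Sup[OF ne bdd] nbhd_chain_nbhd0[OF V, of "Suc n"]] by blast
    then have "(Sup D - a) + a \<in> V n" by (intro nbhd_chain_add[OF V]) (auto simp: D_def)
    then show "Sup D \<in> V n" by simp
  next
    fix s assume "0 \<le> s" "s \<le> e" "\<forall>n. s \<in> V n"
    then show "s \<le> Sup D" using bdd by (intro cSup_upper) (auto simp: D_def)
  qed
qed

text \<open>Let \<open>P\<close> be the set of all elements \<open>p\<close> as just found, for all chains. By the Hausdorff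
  property, \<open>P\<close> has infimum \<open>0\<close>: every neighbourhood of zero contains the tail of some chain and
  so contains an element of \<open>P\<close>. The countable sup property selects a sequence in \<open>P\<close> with infimum
  \<open>0\<close>, and a single chain that refines the countably many chains which belong to it has an
  intersection that meets \<open>[0, e]\<close> only in \<open>0\<close>.\<close>

lemma exists_separating_chain:
  fixes T :: "'a::{archimedean_vector_lattice, conditionally_complete_lattice} topology"
  assumes csp: "countable_sup_property TYPE('a)"
    and T: "Hausdorff_space T" "uo_Lebesgue T" and e: "0 \<le> e"
  obtains V where "nbhd_chain T V" "\<forall>s. 0 \<le> s \<longrightarrow> s \<le> e \<longrightarrow> (\<forall>n. s \<in> V n) \<longrightarrow> s = 0"
proof -
  have lin: "linear_topology T" and sol: "locally_solid T"
    using T(2) by (auto simp: uo_Lebesgue_def)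
  define dom where "dom p V \<longleftrightarrow> nbhd_chain T V \<and> (\<forall>s. 0 \<le> s \<longrightarrow> s \<le> e \<longrightarrow> (\<forall>n. s \<in> V n) \<longrightarrow> s \<le> p)"
    for p V
  define P where "P = {p. \<exists>V. dom p V \<and> (\<forall>n. p \<in> V n)}"
  have ex: "\<exists>p\<in>P. \<forall>n. p \<in> V n" if V: "nbhd_chain T V" for V
  proof -
    obtain p where "\<forall>n. p \<in> V n" "\<forall>s. 0 \<le> s \<longrightarrow> s \<le> e \<longrightarrow> (\<forall>n. s \<in> V n) \<longrightarrow> s \<le> p"
      by (rule exists_greatest_in_chain_Inter[OF T(2) V e])
    then show ?thesis using V by (auto simp: P_def dom_def)
  qed
  have P_nonneg: "0 \<le> p" if p: "p \<in> P" for p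
  proof -
    obtain V where V: "dom p V" using p by (auto simp: P_def)
    then have "nbhd_chain T V" by (simp add: dom_def)
    then have "0 \<in> V n" for n by (rule nbhd0_zero[OF nbhd_chain_nbhd0])
    then show ?thesis using V e by (simp add: dom_def)
  qed
  have "nbhd0 T UNIV" using lin unfolding nbhd0_def linear_topology_def
    by (metis UNIV_I openin_topspace subset_UNIV)
  then obtain V\<^sub>0 where "nbhd_chain T V\<^sub>0" by (rule exists_nbhd_chain[OF lin sol])
  then have P_ne: "P \<noteq> {}" using ex by blast
  have inf_P: "q \<le> 0" if q: "\<And>p. p \<in> P \<Longrightarrow> q \<le> p" for q
  proof -
    have "sup q 0 \<in> U" if U: "nbhd0 T U" for U
    proof -
      obtain V where V: "nbhd_chain T V" "\<forall>n. V (Suc n) \<subseteq> U"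
        by (rule exists_nbhd_chain[OF lin sol U])
      obtain p where p: "p \<in> P" "\<And>n. p \<in> V n" using ex[OF V(1)] by blast
      have "\<bar>sup q 0\<bar> \<le> \<bar>p\<bar>" using q[OF p(1)] P_nonneg[OF p(1)] by simp
      then have "sup q 0 \<in> V (Suc 0)" using nbhd_chain_solid[OF V(1)] p(2) by blast
      then show ?thesis using V(2) by blast
    qed
    then have "sup q 0 = 0" by (rule Hausdorff_nbhd0_eq_0[OF lin T(1)])
    then show ?thesis by (metis sup_ge1)
  qed
  have "isLub UNIV (uminus ` P) 0"
    unfolding isLub_UNIV_iff
  proof (intro conjI ballI allI impI)
    fix u assume "\<forall>y\<in>uminus ` P. y \<le> u"
    then have "- u \<le> p" if "p \<in> P" for p using that by (auto simp: minus_le_iff)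
    then have "- u \<le> 0" by (rule inf_P)
    then show "0 \<le> u" by simp
  qed (use P_nonneg in auto)
  then obtain C where C: "C \<subseteq> uminus ` P" "countable C" "isLub UNIV C 0"
    using csp P_ne unfolding countable_sup_property_def by (metis image_is_empty)
  \<comment> \<open>The set \<open>C\<close> might be empty; one element is added before it is enumerated.\<close>
  obtain p0 where p0: "p0 \<in> P" using P_ne by blast
  let ?C = "insert (- p0) C"
  define p where "p k = - from_nat_into ?C k" for k
  have range: "range (from_nat_into ?C) = ?C"
    using C(2) by (intro range_from_nat_into) auto
  have pP: "p k \<in> P" for k
  proof -
    have "from_nat_into ?C k \<in> ?C" using from_nat_into[of ?C k] by simp
    then show ?thesis using C(1) p0 unfolding p_def by auto
  qed
  have inf_p: "q \<le> 0" if q: "\<And>k. q \<le> p k" for q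
  proof -
    have "c \<le> - q" if c: "c \<in> C" for c
    proof -
      obtain k where "c = from_nat_into ?C k" using c range by blast
      then show ?thesis using q[of k] by (simp add: p_def le_minus_iff)
    qed
    then have "0 \<le> - q" using C(3) unfolding isLub_UNIV_iff by blast
    then show ?thesis by simp
  qed
  have "\<forall>k. \<exists>V. dom (p k) V" using pP by (auto simp: P_def)
  then obtain W where W: "\<And>k. dom (p k) (W k)" by metis
  have nb: "nbhd0 T (case prod_decode i of (k, n) \<Rightarrow> W k n)" for i
  proof -
    have "nbhd0 T (W k n)" for k n
      using W[of k] nbhd_chain_nbhd0 unfolding dom_def by blast
    then show ?thesis by (simp split: prod.split)
  qed
  obtain V where V: "nbhd_chain T V"
      "\<forall>i. V (Suc i) \<subseteq> (case prod_decode i of (k, n) \<Rightarrow> W k n)"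
    by (rule exists_nbhd_chain[OF lin sol nb])
  have VW: "V (Suc (prod_encode (k, n))) \<subseteq> W k n" for k n
    using V(2)[rule_format, of "prod_encode (k, n)"] by simp
  show thesis
  proof (rule that[OF V(1)]; intro allI impI)
    fix s assume s: "0 \<le> s" "s \<le> e" "\<forall>n. s \<in> V n"
    have "s \<le> p k" for k
      using W[of k] s VW[of k] unfolding dom_def by blast
    then have "s \<le> 0" by (rule inf_p)
    then show "s = 0" using s(1) by simp
  qed
qed

text \<open>The suprema \<open>y n\<close> of the tails of \<open>\<bar>f k - x\<bar>\<close> dominate the differences. Finite parts of such a
  supremum lie below finite sums, which the chain condition keeps in \<open>V (Suc n)\<close>; the whole
  supremum \<open>y (Suc n)\<close> is therefore in \<open>V n\<close>. By solidness, every positive lower bound of \<open>y\<close>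
  is in all \<open>V n\<close>, so that \<open>y\<close> decreases to \<open>0\<close>.\<close>

lemma order_conv_of_nbhd_chain:
  fixes T :: "'a::{archimedean_vector_lattice, conditionally_complete_lattice} topology"
  assumes T: "uo_Lebesgue T" and V: "nbhd_chain T V"
    and sep: "\<forall>s. 0 \<le> s \<longrightarrow> s \<le> w \<longrightarrow> (\<forall>n. s \<in> V n) \<longrightarrow> s = 0"
    and f: "\<And>n. f n - x \<in> V n" "\<And>n. \<bar>f n - x\<bar> \<le> w"
  shows "order_conv UNIV (\<le>) f x"
proof -
  define d where "d n = \<bar>f n - x\<bar>" for n
  have dV: "d n \<in> V n" for n
    using nbhd_chain_solid[OF V f(1)] by (simp add: d_def)
  have d0: "0 \<le> d n" and dw: "d n \<le> w" for n using f(2) by (auto simp: d_def)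
  have bdd: "bdd_above (d ` A)" for A using dw by (auto intro!: bdd_aboveI[of _ w])
  define y where "y n = Sup (d ` {n<..})" for n
  have y_ge: "d k \<le> y n" if "n < k" for n k
    unfolding y_def using that by (intro cSup_upper bdd) auto
  have y_le: "y n \<le> u" if "\<And>k. n < k \<Longrightarrow> d k \<le> u" for n u
    unfolding y_def using that by (intro cSup_least) auto
  have y0: "0 \<le> y n" for n using d0 y_ge[of n "Suc n"] order_trans by blast
  have yV: "y (Suc n) \<in> V n" for n
  proof -
    \<comment> \<open>\<open>Suc j\<close> rather than \<open>j\<close>, because the index set must not be empty.\<close>
    define z where "z j = Sup (d ` {Suc n<..Suc n + Suc j})" for j
    have z_ge: "d k \<le> z j" if "Suc n < k" "k \<le> Suc n + Suc j" for k j
      unfolding z_def using that by (intro cSup_upper bdd) auto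
    have z_le: "z j \<le> u" if "\<And>k. Suc n < k \<Longrightarrow> k \<le> Suc n + Suc j \<Longrightarrow> d k \<le> u" for j u
      unfolding z_def using that by (intro cSup_least) auto
    have mono: "z i \<le> z j" if "i \<le> j" for i j
      using that by (intro z_le z_ge) auto
    have "isLub UNIV (range z) (y (Suc n))"
      unfolding isLub_UNIV_iff
    proof (intro conjI ballI allI impI)
      fix a assume "a \<in> range z"
      then obtain j where "a = z j" by blast
      then show "a \<le> y (Suc n)" using y_ge z_le by blast
    next
      fix u assume "\<forall>a\<in>range z. a \<le> u"
      then have "z j \<le> u" for j by blast
      then have "d k \<le> u" if "Suc n < k" for k
        using order_trans[OF z_ge[of k k]] that by simp
      then show "y (Suc n) \<le> u" by (rule y_le)
    qed
    moreover have "\<exists>c\<in>range z. a \<le> c \<and> b \<le> c" if ab: "a \<in> range z" "b \<in> range z" for a b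
    proof -
      obtain i j where "a = z i" "b = z j" using ab by blast
      then show ?thesis using mono[of i "max i j"] mono[of j "max i j"] by auto
    qed
    ultimately obtain j where j: "y (Suc n) - z j \<in> V (Suc n)"
      using isLub_nbhd0[OF T _ _ _ nbhd_chain_nbhd0[OF V, of "Suc n"], of "range z" "y (Suc n)"] by blast
    let ?s = "\<Sum>k\<in>{Suc n<..Suc n + Suc j}. d k"
    have "z j \<le> ?s"
    proof (rule z_le)
      fix k assume "Suc n < k" "k \<le> Suc n + Suc j"
      then show "d k \<le> ?s"
        using d0 sum_mono2[of "{Suc n<..Suc n + Suc j}" "{k}" d] by simp
    qed
    moreover have "0 \<le> z j" 
      using order_trans[OF d0 z_ge[of "Suc (Suc n)" j]] by simp
    moreover have "0 \<le> ?s" using d0 by (intro sum_nonneg) auto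
    ultimately have "\<bar>z j\<bar> \<le> \<bar>?s\<bar>" by simp
    then have "z j \<in> V (Suc n)" using nbhd_chain_solid[OF V nbhd_chain_sum[OF V dV]] by blast
    then have "(y (Suc n) - z j) + z j \<in> V n" using j nbhd_chain_add[OF V] by blast
    then show ?thesis by simp
  qed
  have mono: "y n \<le> y m" if "m \<le> n" for m n using that by (intro y_le y_ge) auto
  have "decreases_to_0 UNIV (\<le>) y"
    unfolding decreases_to_0_def isGlb_UNIV_iff
  proof (intro conjI ballI allI impI)
    show "directed (UNIV :: nat set) (\<le>)" by (rule directed_nat)
    fix q assume "\<forall>z\<in>range y. q \<le> z"
    then have q: "q \<le> y n" for n by blast
    have "sup q 0 = 0"
    proof (rule sep[rule_format])
      show "sup q 0 \<le> w" using q[of 0] y_le[of 0 w] dw d0[of 0] order_trans by (metis le_sup_iff)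
      fix n
      have "\<bar>sup q 0\<bar> \<le> \<bar>y (Suc n)\<bar>" using q[of "Suc n"] y0[of "Suc n"] by simp
      then show "sup q 0 \<in> V n" using nbhd_chain_solid[OF V yV] by blast
    qed simp
    then show "q \<le> 0" by (metis sup_ge1)
  qed (use y0 mono in auto)
  then show ?thesis
  proof (rule order_convI)
    fix n
    have "\<bar>x - f k\<bar> \<le> y n" if "Suc n \<le> k" for k
      using y_ge[of n k] that by (simp add: d_def abs_minus_commute)
    then show "eventually_net UNIV (\<le>) (\<lambda>a. \<bar>x - f a\<bar> \<le> y n)"
      unfolding eventually_net_def by blast
  qed
qed

section \<open>Closures and adherences\<close>

lemma abs_clip_diff_le:
  fixes c x m :: "'a::lattice_ab_group_add_abs"
  assumes "\<bar>x\<bar> \<le> m"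
  shows "\<bar>sup (inf c m) (- m) - x\<bar> \<le> \<bar>c - x\<bar>"
proof -
  have x: "x \<le> m" "- m \<le> x" using assms abs_le_iff[of x m] by (auto simp: minus_le_iff)
  have c: "c \<le> x + \<bar>c - x\<bar>" "x - \<bar>c - x\<bar> \<le> c"
    using abs_ge_self[of "c - x"] abs_ge_minus_self[of "c - x"] by (simp_all add: algebra_simps)
  have "inf c m \<le> x + \<bar>c - x\<bar>" using c(1) by (rule le_infI1)
  moreover have "- m \<le> x + \<bar>c - x\<bar>" using x(2) by (rule order_trans) simp
  ultimately have 1: "sup (inf c m) (- m) \<le> x + \<bar>c - x\<bar>" by simp
  have "x - \<bar>c - x\<bar> \<le> x" by simp
  then have "x - \<bar>c - x\<bar> \<le> m" using x(1) by (rule order_trans)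
  then have 2: "x - \<bar>c - x\<bar> \<le> sup (inf c m) (- m)" using c(2) by (simp add: le_supI1)
  have "\<bar>s - x\<bar> \<le> d" if "s \<le> x + d" "x - d \<le> s" for s d
    using that by (intro abs_leI) (simp_all add: algebra_simps)
  from this[OF 1 2] show ?thesis .
qed

text \<open>Each approximation is found in three steps: an element \<open>c\<close> of the closure that is \<open>T\<close>-close to
  \<open>x\<close>, its truncation \<open>c'\<close>, which stays in the closure because the latter is a sublattice with
  \<open>e\<close>, and an element \<open>b\<close> of \<open>B\<close> within \<open>\<delta> e\<close> of \<open>c'\<close>. Since \<open>\<delta> \<le> 1\<close>, all distances to \<open>x\<close> stay below
  the fixed bound \<open>e + 2 m e\<close>.\<close>

lemma closure_subset_sigma_o_adherence:
  fixes e :: "'a::{f_algebra, conditionally_complete_lattice}"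
  assumes e: "unital_f_algebra e"
    and csp: "countable_sup_property TYPE('a)"
    and T: "Hausdorff_space T" "uo_Lebesgue T"
    and B: "subalgebra B"
    and u: "u \<in> order_unit_topology e closure_of B" "strong_order_unit u"
  shows "T closure_of (order_unit_topology e closure_of B) \<subseteq> sigma_o_adherence B"
proof
  interpret unital_f_algebra e by (rule e)
  let ?C = "order_unit_topology e closure_of B"
  have C: "subalgebra ?C" "uniformly_closed ?C"
    by (rule subalgebra_closure[OF B] uniformly_closed_closure)+
  then have sub: "subspace ?C" by (simp add: subalgebra_def)
  have eC: "e \<in> ?C" by (rule unit_mem[OF C u])
  have lin: "linear_topology T" using T(2) by (simp add: uo_Lebesgue_def)
  fix x assume x: "x \<in> T closure_of ?C"
  obtain m where m: "0 < m" "\<bar>x\<bar> \<le> m *\<^sub>R e" by (rule order_unit_bound)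
  have m0: "0 \<le> m *\<^sub>R e" using m(1) e_nonneg by (simp add: scaleR_nonneg_nonneg)
  define w where "w = e + m *\<^sub>R e + m *\<^sub>R e"
  have "0 \<le> w" using e_nonneg m0 by (simp add: w_def)
  then obtain V where V: "nbhd_chain T V"
      "\<forall>s. 0 \<le> s \<longrightarrow> s \<le> w \<longrightarrow> (\<forall>n. s \<in> V n) \<longrightarrow> s = 0"
    by (rule exists_separating_chain[OF csp T])
  have "\<exists>b. b \<in> B \<and> b - x \<in> V n \<and> \<bar>b - x\<bar> \<le> w" for n
  proof -
    note nb = nbhd_chain_nbhd0[OF V(1), of "Suc n"]
    obtain c where c: "c \<in> ?C" "c - x \<in> V (Suc n)" using closure_of_nbhd0[OF lin x nb] by blast
    define c' where "c' = sup (inf c (m *\<^sub>R e)) (- (m *\<^sub>R e))"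
    have c'C: "c' \<in> ?C"
      unfolding c'_def by (intro sup_inf_mem[OF C] c subspace_neg[OF sub] subspace_scale[OF sub] eC)
    have "- (m *\<^sub>R e) \<le> m *\<^sub>R e"
      using m0 neg_le_0_iff_le order_trans by blast
    then have "c' \<le> m *\<^sub>R e" "- (m *\<^sub>R e) \<le> c'" by (simp_all add: c'_def)
    then have c'm: "\<bar>c'\<bar> \<le> m *\<^sub>R e" by (intro abs_leI) (auto simp: minus_le_iff)
    have "\<bar>c' - x\<bar> \<le> \<bar>c - x\<bar>" unfolding c'_def by (rule abs_clip_diff_le[OF m(2)])
    then have c'V: "c' - x \<in> V (Suc n)" by (rule nbhd_chain_solid[OF V(1) c(2)])
    obtain \<delta> where \<delta>: "0 < \<delta>" "\<delta> \<le> 1" "\<delta> *\<^sub>R e \<in> V (Suc n)"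
      by (rule small_multiple_in_nbhd0[OF lin nb])
    obtain b where b: "b \<in> B" "\<bar>c' - b\<bar> \<le> \<delta> *\<^sub>R e"
      using c'C \<delta>(1) unfolding in_order_unit_closure_iff by blast
    have "0 \<le> \<delta> *\<^sub>R e" using \<delta>(1) e_nonneg by (simp add: scaleR_nonneg_nonneg)
    then have "\<bar>b - c'\<bar> \<le> \<bar>\<delta> *\<^sub>R e\<bar>" using b(2) by (simp add: abs_minus_commute)
    then have "b - c' \<in> V (Suc n)" by (rule nbhd_chain_solid[OF V(1) \<delta>(3)])
    from nbhd_chain_add[OF V(1) this c'V] have bV: "b - x \<in> V n" by simp
    have "\<delta> *\<^sub>R e \<le> 1 *\<^sub>R e" using \<delta>(2) e_nonneg by (rule scaleR_right_mono)
    then have be: "\<bar>b - c'\<bar> \<le> e" using b(2) by (simp add: abs_minus_commute)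
    have "b - x = (b - c') + c' + (- x)" by simp
    then have "\<bar>b - x\<bar> \<le> \<bar>b - c'\<bar> + \<bar>c'\<bar> + \<bar>- x\<bar>"
      using abs_triangle_ineq[of "b - c'" c'] abs_triangle_ineq[of "b - c' + c'" "- x"]
      by (metis add_right_mono order_trans)
    also have "\<dots> \<le> w" unfolding w_def abs_minus_cancel by (intro add_mono be c'm m(2))
    finally show ?thesis using b(1) bV by blast
  qed
  then obtain f where f: "\<And>n. f n \<in> B" "\<And>n. f n - x \<in> V n" "\<And>n. \<bar>f n - x\<bar> \<le> w" by metis
  have "order_conv UNIV (\<le>) f x" by (rule order_conv_of_nbhd_chain[OF T(2) V f(2,3)])
  then show "x \<in> sigma_o_adherence B" using f(1) unfolding sigma_o_adherence_def by blast
qed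

theorem theorem6p15:
  fixes e :: "'a::{f_algebra, conditionally_complete_lattice}"
    and T :: "'a topology"
    and B :: "'a set"
  assumes "countable_sup_property TYPE('a)"
    and "\<And>x. e * x = x" and "\<And>x. x * e = x"
    and "strong_order_unit e"
    and "order_unit_complete e"
    and "Hausdorff_space T" and "uo_Lebesgue T"
    and "subalgebra B"
    and "\<exists>u \<in> order_unit_topology e closure_of B. strong_order_unit u"
  shows "let C = order_unit_topology e closure_of B in
      T closure_of B = sigma_o_adherence B
    \<and> sigma_o_adherence B = o_adherence B
    \<and> o_adherence B = sigma_uo_adherence B
    \<and> sigma_uo_adherence B = uo_adherence B
    \<and> uo_adherence B = T closure_of C
    \<and> T closure_of C = sigma_o_adherence C
    \<and> sigma_o_adherence C = o_adherence C
    \<and> o_adherence C = sigma_uo_adherence C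
    \<and> sigma_uo_adherence C = uo_adherence C"
proof -
  interpret unital_f_algebra e by unfold_locales (fact assms)+
  let ?C = "order_unit_topology e closure_of B"
  obtain u where u: "u \<in> ?C" "strong_order_unit u" using assms(9) by blast
  note incl = adherence_inclusions uo_adherence_subset_closure[OF assms(7)]
  have "T closure_of ?C \<subseteq> sigma_o_adherence B"
    by (rule closure_subset_sigma_o_adherence[OF unital_f_algebra_axioms assms(1,6,7,8) u])
  moreover have "T closure_of B \<subseteq> T closure_of ?C"
    by (rule closure_of_mono[OF subset_order_unit_closure])
  moreover have "sigma_o_adherence B \<subseteq> sigma_o_adherence ?C"
    by (rule sigma_o_adherence_mono[OF subset_order_unit_closure])
  ultimately show ?thesis
    unfolding Let_def using incl[of B] incl[of ?C] by (intro conjI equalityI) (meson subset_trans)+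
qed

end
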